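(* (Working in ZFC.) The class $\mathrm{HOA}$ of hereditarily ordinal algebraic sets equals the class $\mathrm{HOD}$ of hereditarily ordinal definable sets: $\mathrm{HOA}=\mathrm{HOD}$.
   Context: For a structure $M$ and $P\subseteq M$, an element $a\in M$ is $P$-definable in $M$ if there is a first-order formula $\varphi(x,\vec p)$ with parameters $\vec p$ from $P$ such that $a$ is the unique $b\in M$ with $M\models\varphi[b,\vec p]$; it is $P$-algebraic in $M$ if there is such a formula such that $\{b\in M\mid M\models\varphi[b,\vec p]\}$ is a finite set containing $a$. A set $a$ is ordinal definable if for some ordinal $\theta$, $a\in V_\theta$ and $a$ is $\theta$-definable in $(V_\theta,\in)$ (i.e. using ordinal parameters below $\theta$); it is ordinal algebraic if for some ordinal $\theta$, $a\in V_\theta$ and $a$ is $\theta$-algebraic in $(V_\theta,\in)$. $\mathrm{HOD}$ is the class of sets $a$ such that every element of the transitive closure of $\{a\}$ is ordinal definable; $\mathrm{HOA}$ is the class of sets $a$ such that every element of the transitive closure of $\{a\}$ is ordinal algebraic. *)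

theory Defs
  imports Main
begin

text \<open>
  ``Working in ZFC'' is rendered as ``in an arbitrary model of first-order ZFC'': a type \<open>'v\<close> with
  a binary relation satisfying the ZFC axioms, where the two schemas range over the first-order
  formulas \<open>fm\<close> only. Ordinals, natural numbers, finiteness, formulas and satisfaction in
  \<open>(V\<^sub>\<theta>, \<in>)\<close> are all the model's own: every quantifier in their definitions ranges over \<open>'v\<close>, so
  each notion is a first-order formula in the membership relation. Neither the natural numbers
  nor the ordinals of the model are assumed to be standard.
\<close>

datatype fm = Mem nat nat | Eq nat nat | Neg fm | Conj fm fm | All nat fm

primrec holds :: "('v \<Rightarrow> 'v \<Rightarrow> bool) \<Rightarrow> (nat \<Rightarrow> 'v) \<Rightarrow> fm \<Rightarrow> bool" where
  "holds mem e (Mem i j) \<longleftrightarrow> mem (e i) (e j)"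
| "holds mem e (Eq i j) \<longleftrightarrow> e i = e j"
| "holds mem e (Neg \<phi>) \<longleftrightarrow> \<not> holds mem e \<phi>"
| "holds mem e (Conj \<phi> \<psi>) \<longleftrightarrow> holds mem e \<phi> \<and> holds mem e \<psi>"
| "holds mem e (All i \<phi>) \<longleftrightarrow> (\<forall>x. holds mem (e(i := x)) \<phi>)"

text \<open>In the schemas the valuation \<open>e\<close> supplies the parameters.\<close>

locale ZFC =
  fixes mem :: "'v \<Rightarrow> 'v \<Rightarrow> bool"  (infix "\<epsilon>" 50)
  assumes extensionality: "(\<forall>z. z \<epsilon> x \<longleftrightarrow> z \<epsilon> y) \<Longrightarrow> x = y"
    and foundation: "\<exists>y. y \<epsilon> x \<Longrightarrow> \<exists>y. y \<epsilon> x \<and> \<not> (\<exists>z. z \<epsilon> x \<and> z \<epsilon> y)"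
    and pairing: "\<exists>z. \<forall>w. w \<epsilon> z \<longleftrightarrow> w = x \<or> w = y"
    and union: "\<exists>u. \<forall>z. z \<epsilon> u \<longleftrightarrow> (\<exists>y. y \<epsilon> x \<and> z \<epsilon> y)"
    and power: "\<exists>p. \<forall>z. z \<epsilon> p \<longleftrightarrow> (\<forall>w. w \<epsilon> z \<longrightarrow> w \<epsilon> x)"
    and infinity: "\<exists>w. (\<exists>o'. o' \<epsilon> w \<and> (\<forall>z. \<not> z \<epsilon> o')) \<and>
          (\<forall>x. x \<epsilon> w \<longrightarrow> (\<exists>y. y \<epsilon> w \<and> (\<forall>z. z \<epsilon> y \<longleftrightarrow> z \<epsilon> x \<or> z = x)))"
    and separation: "\<exists>b. \<forall>x. x \<epsilon> b \<longleftrightarrow> x \<epsilon> a \<and> holds mem (e(0 := x)) \<phi>"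
    and replacement: "(\<forall>x y y'. x \<epsilon> a \<and> holds mem (e(0 := x, 1 := y)) \<phi> \<and>
            holds mem (e(0 := x, 1 := y')) \<phi> \<longrightarrow> y = y') \<Longrightarrow>
          \<exists>b. \<forall>y. y \<epsilon> b \<longleftrightarrow> (\<exists>x. x \<epsilon> a \<and> holds mem (e(0 := x, 1 := y)) \<phi>)"
    and choice: "(\<forall>x. x \<epsilon> a \<longrightarrow> (\<exists>z. z \<epsilon> x)) \<Longrightarrow>
          (\<forall>x y. x \<epsilon> a \<and> y \<epsilon> a \<and> x \<noteq> y \<longrightarrow> \<not> (\<exists>z. z \<epsilon> x \<and> z \<epsilon> y)) \<Longrightarrow>
          \<exists>c. \<forall>x. x \<epsilon> a \<longrightarrow> (\<exists>!z. z \<epsilon> x \<and> z \<epsilon> c)"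

context
  fixes mem :: "'v \<Rightarrow> 'v \<Rightarrow> bool"  (infix "\<epsilon>" 50)
begin

text \<open>
  Below, \<open>the_set P\<close> is only applied to predicates \<open>P\<close> whose extension is a set in every model of
  ZFC; it is unique by extensionality.
\<close>

definition the_set :: "('v \<Rightarrow> bool) \<Rightarrow> 'v" where
  "the_set P = (THE x. \<forall>z. z \<epsilon> x \<longleftrightarrow> P z)"

definition sub :: "'v \<Rightarrow> 'v \<Rightarrow> bool" where
  "sub x y \<longleftrightarrow> (\<forall>z. z \<epsilon> x \<longrightarrow> z \<epsilon> y)"

definition zero :: 'v where
  "zero = the_set (\<lambda>z. False)"

definition succ :: "'v \<Rightarrow> 'v" where
  "succ x = the_set (\<lambda>z. z \<epsilon> x \<or> z = x)"

primrec num :: "nat \<Rightarrow> 'v" where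
  "num 0 = zero"
| "num (Suc k) = succ (num k)"

definition upair :: "'v \<Rightarrow> 'v \<Rightarrow> 'v" where
  "upair x y = the_set (\<lambda>z. z = x \<or> z = y)"

definition pair :: "'v \<Rightarrow> 'v \<Rightarrow> 'v" where
  "pair x y = upair (upair x x) (upair x y)"

definition transitive :: "'v \<Rightarrow> bool" where
  "transitive x \<longleftrightarrow> (\<forall>y. y \<epsilon> x \<longrightarrow> sub y x)"

definition trcl :: "'v \<Rightarrow> 'v" where
  "trcl x = the_set (\<lambda>z. \<forall>t. transitive t \<and> sub x t \<longrightarrow> z \<epsilon> t)"

definition ordinal :: "'v \<Rightarrow> bool" where
  "ordinal x \<longleftrightarrow> transitive x \<and>
     (\<forall>y z. y \<epsilon> x \<and> z \<epsilon> x \<longrightarrow> y \<epsilon> z \<or> y = z \<or> z \<epsilon> y) \<and>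
     (\<forall>s. sub s x \<and> (\<exists>y. y \<epsilon> s) \<longrightarrow> (\<exists>m. m \<epsilon> s \<and> (\<forall>y. y \<epsilon> s \<longrightarrow> \<not> y \<epsilon> m)))"

definition natural :: "'v \<Rightarrow> bool" where
  "natural n \<longleftrightarrow> ordinal n \<and> (\<forall>m. m \<epsilon> n \<or> m = n \<longrightarrow> m = zero \<or> (\<exists>k. m = succ k))"

definition fun_from_to :: "'v \<Rightarrow> 'v \<Rightarrow> 'v \<Rightarrow> bool" where
  "fun_from_to f d c \<longleftrightarrow>
     (\<forall>z. z \<epsilon> f \<longrightarrow> (\<exists>x y. x \<epsilon> d \<and> y \<epsilon> c \<and> z = pair x y)) \<and>
     (\<forall>x. x \<epsilon> d \<longrightarrow> (\<exists>!y. pair x y \<epsilon> f))"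

definition app :: "'v \<Rightarrow> 'v \<Rightarrow> 'v" where
  "app f x = (THE y. pair x y \<epsilon> f)"

definition finite_set :: "'v \<Rightarrow> bool" where
  "finite_set x \<longleftrightarrow> (\<exists>n f. natural n \<and> fun_from_to f n x \<and> (\<forall>y. y \<epsilon> x \<longrightarrow> (\<exists>!i. i \<epsilon> n \<and> app f i = y)))"

text \<open>\<open>V\<^sub>\<theta>\<close>, by the recursion \<open>V\<^sub>\<beta> = \<Union>\<gamma><\<beta>. Pow V\<^sub>\<gamma>\<close>; \<open>h\<close> is the function \<open>\<beta> \<mapsto> V\<^sub>\<beta>\<close> on \<open>\<theta> + 1\<close>.\<close>

definition V :: "'v \<Rightarrow> 'v" where
  "V \<theta> = (THE v. \<exists>h c. fun_from_to h (succ \<theta>) c \<and>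
     (\<forall>\<beta>. \<beta> \<epsilon> succ \<theta> \<longrightarrow> (\<forall>x. x \<epsilon> app h \<beta> \<longleftrightarrow> (\<exists>\<gamma>. \<gamma> \<epsilon> \<beta> \<and> sub x (app h \<gamma>)))) \<and>
     v = app h \<theta>)"

text \<open>
  Codes of the first-order formulas of set theory. \<open>formula n f\<close> says that \<open>f\<close> codes a formula
  whose free variables are among \<open>x\<^sub>0, \<dots>, x\<^sub>n\<^sub>-\<^sub>1\<close>. Bound variables are named by de Bruijn levels:
  the quantifier of a formula \<open>all_code f\<close> with free variables among \<open>x\<^sub>0, \<dots>, x\<^sub>n\<^sub>-\<^sub>1\<close> binds \<open>x\<^sub>n\<close>. An
  assignment for such a formula is a function with domain \<open>n = {0, \<dots>, n - 1}\<close>.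
\<close>

definition mem_code :: "'v \<Rightarrow> 'v \<Rightarrow> 'v" where
  "mem_code i j = pair (num 0) (pair i j)"

definition eq_code :: "'v \<Rightarrow> 'v \<Rightarrow> 'v" where
  "eq_code i j = pair (num 1) (pair i j)"

definition neg_code :: "'v \<Rightarrow> 'v" where
  "neg_code f = pair (num 2) f"

definition conj_code :: "'v \<Rightarrow> 'v \<Rightarrow> 'v" where
  "conj_code f g = pair (num 3) (pair f g)"

definition all_code :: "'v \<Rightarrow> 'v" where
  "all_code f = pair (num 4) f"

definition formula_closed :: "'v \<Rightarrow> bool" where
  "formula_closed X \<longleftrightarrow> (\<forall>n. natural n \<longrightarrow>
     (\<forall>i j. i \<epsilon> n \<and> j \<epsilon> n \<longrightarrow> pair n (mem_code i j) \<epsilon> X \<and> pair n (eq_code i j) \<epsilon> X) \<and>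
     (\<forall>f. pair n f \<epsilon> X \<longrightarrow> pair n (neg_code f) \<epsilon> X) \<and>
     (\<forall>f g. pair n f \<epsilon> X \<and> pair n g \<epsilon> X \<longrightarrow> pair n (conj_code f g) \<epsilon> X) \<and>
     (\<forall>f. pair (succ n) f \<epsilon> X \<longrightarrow> pair n (all_code f) \<epsilon> X))"

definition formula :: "'v \<Rightarrow> 'v \<Rightarrow> bool" where
  "formula n f \<longleftrightarrow> natural n \<and> (\<forall>X. formula_closed X \<longrightarrow> pair n f \<epsilon> X)"

text \<open>For an assignment \<open>s\<close> with domain \<open>n\<close>, \<open>extend s n a\<close> is the sequence \<open>s\<close> followed by \<open>a\<close>.\<close>

definition extend :: "'v \<Rightarrow> 'v \<Rightarrow> 'v \<Rightarrow> 'v" where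
  "extend s n a = the_set (\<lambda>z. z \<epsilon> s \<or> z = pair n a)"

text \<open>Tarski's clauses for the structure \<open>(M, \<in>)\<close>; \<open>T\<close> consists of pairs (formula, assignment).\<close>

definition satisfaction_set :: "'v \<Rightarrow> 'v \<Rightarrow> bool" where
  "satisfaction_set M T \<longleftrightarrow> (\<forall>n s. natural n \<and> fun_from_to s n M \<longrightarrow>
     (\<forall>i j. i \<epsilon> n \<and> j \<epsilon> n \<longrightarrow> (pair (mem_code i j) s \<epsilon> T \<longleftrightarrow> app s i \<epsilon> app s j)) \<and>
     (\<forall>i j. i \<epsilon> n \<and> j \<epsilon> n \<longrightarrow> (pair (eq_code i j) s \<epsilon> T \<longleftrightarrow> app s i = app s j)) \<and>
     (\<forall>f. formula n f \<longrightarrow> (pair (neg_code f) s \<epsilon> T \<longleftrightarrow> \<not> pair f s \<epsilon> T)) \<and>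
     (\<forall>f g. formula n f \<and> formula n g \<longrightarrow>
        (pair (conj_code f g) s \<epsilon> T \<longleftrightarrow> pair f s \<epsilon> T \<and> pair g s \<epsilon> T)) \<and>
     (\<forall>f. formula (succ n) f \<longrightarrow>
        (pair (all_code f) s \<epsilon> T \<longleftrightarrow> (\<forall>a. a \<epsilon> M \<longrightarrow> pair f (extend s n a) \<epsilon> T))))"

definition satisfies :: "'v \<Rightarrow> 'v \<Rightarrow> 'v \<Rightarrow> bool" where
  "satisfies M f s \<longleftrightarrow> (\<exists>T. satisfaction_set M T \<and> pair f s \<epsilon> T)"

text \<open>
  In a formula \<open>\<phi>(x, p\<^sub>0, \<dots>, p\<^sub>n\<^sub>-\<^sub>1)\<close> with parameters, the variables \<open>x\<^sub>0, \<dots>, x\<^sub>n\<^sub>-\<^sub>1\<close> stand for the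
  parameters and \<open>x\<^sub>n\<close> is the variable \<open>x\<close>.
\<close>

definition definable_in :: "'v \<Rightarrow> 'v \<Rightarrow> 'v \<Rightarrow> bool" where
  "definable_in M P a \<longleftrightarrow> (\<exists>n f p. natural n \<and> formula (succ n) f \<and> fun_from_to p n P \<and>
     (\<forall>b. b \<epsilon> M \<and> satisfies M f (extend p n b) \<longleftrightarrow> b = a))"

definition algebraic_in :: "'v \<Rightarrow> 'v \<Rightarrow> 'v \<Rightarrow> bool" where
  "algebraic_in M P a \<longleftrightarrow> (\<exists>n f p B. natural n \<and> formula (succ n) f \<and> fun_from_to p n P \<and>
     (\<forall>b. b \<epsilon> B \<longleftrightarrow> b \<epsilon> M \<and> satisfies M f (extend p n b)) \<and> finite_set B \<and> a \<epsilon> B)"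

text \<open>The set of ordinals below \<open>\<theta>\<close> is \<open>\<theta>\<close> itself.\<close>

definition ordinal_definable :: "'v \<Rightarrow> bool" where
  "ordinal_definable a \<longleftrightarrow> (\<exists>\<theta>. ordinal \<theta> \<and> a \<epsilon> V \<theta> \<and> definable_in (V \<theta>) \<theta> a)"

definition ordinal_algebraic :: "'v \<Rightarrow> bool" where
  "ordinal_algebraic a \<longleftrightarrow> (\<exists>\<theta>. ordinal \<theta> \<and> a \<epsilon> V \<theta> \<and> algebraic_in (V \<theta>) \<theta> a)"

definition HOD :: "'v set" where
  "HOD = {a. \<forall>x. x \<epsilon> trcl (upair a a) \<longrightarrow> ordinal_definable x}"

definition HOA :: "'v set" where
  "HOA = {a. \<forall>x. x \<epsilon> trcl (upair a a) \<longrightarrow> ordinal_algebraic x}"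

end

end

theory Submission
  imports Defs
begin

text \<open>
  Suppose \<open>a\<close> is ordinal algebraic and all its elements are ordinal definable. Call \<open>X\<close> an OD set if
  some \<open>V\<^sub>\<theta>\<close> has \<open>X\<close> as a definable subset with ordinal parameters. Start with a finite OD set \<open>B\<close>
  containing \<open>a\<close> and run through its elements \<open>b\<^sub>0, \<dots>, b\<^sub>n\<^sub>-\<^sub>1\<close>: whenever \<open>a\<close> is not a subset of \<open>b\<^sub>i\<close>,
  choose \<open>d \<in> a - b\<^sub>i\<close> and discard all members of the current set that do not contain \<open>d\<close>. As \<open>d\<close> is
  ordinal definable, the smaller set is again OD, and at the end \<open>a\<close> is the \<open>\<subseteq>\<close>-least member of
  an OD set, hence ordinal definable. The equality of the two classes follows by \<open>\<in>\<close>-induction.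

  The induction over \<open>i\<close> takes place inside the model and \<open>n\<close> may be nonstandard, so there is no
  bound on the formulas involved. They are combined by relativizing coded formulas from \<open>V\<^sub>\<alpha>\<close> to a
  larger \<open>V\<^sub>\<theta>\<close>, which needs only that \<open>V\<^sub>\<alpha>\<close> is definable in \<open>V\<^sub>\<theta>\<close> from \<open>\<alpha>\<close>; neither the
  reflection theorem nor a definable well-ordering of the ordinal definable sets is used.
\<close>

section \<open>First-order definability\<close>

text \<open>The schemas of the model apply only to first-order predicates with parameters, so every
  induction or recursion inside it carries the obligation to show that its predicate is of that
  kind. The calculus of \<open>fo\<close> and \<open>fot\<close> discharges these obligations by
  composition. For ordinal definability the obligation can be met because satisfaction in the set
  V_\<theta> is itself a first-order notion: "some level, some coded formula and some parameter
  sequence cut out X" is a single first-order statement, although the coded formula may be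
  nonstandard.

  The induction over the enumeration only claims that such a level, formula and sequence exist at
  stage i. Hence no sequence of chosen sets d has to be kept, and the levels may grow from stage to
  stage; one step only has to combine two definitions. Each old level enters the combined definition
  as one more ordinal parameter.

  The set a survives every step because d is taken from a, whereas a b_i that does not include a is
  gone after stage i. Thus every b_i that remains after all the stages includes a.\<close>

primrec free_vars :: "fm \<Rightarrow> nat set" where
  "free_vars (Mem i j) = {i, j}"
| "free_vars (Eq i j) = {i, j}"
| "free_vars (Neg \<phi>) = free_vars \<phi>"
| "free_vars (Conj \<phi> \<psi>) = free_vars \<phi> \<union> free_vars \<psi>"
| "free_vars (All i \<phi>) = free_vars \<phi> - {i}"

lemma finite_free_vars: "finite (free_vars \<phi>)"
  by (induction \<phi>) auto

lemma holds_cong: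
  "(\<And>i. i \<in> free_vars \<phi> \<Longrightarrow> e i = e' i) \<Longrightarrow> holds mem e \<phi> \<longleftrightarrow> holds mem e' \<phi>"
proof (induction \<phi> arbitrary: e e')
  case (All i \<phi>)
  have "holds mem (e(i := x)) \<phi> \<longleftrightarrow> holds mem (e'(i := x)) \<phi>" for x
    by (rule All.IH) (use All.prems in auto)
  then show ?case by simp
next
  case (Conj \<phi> \<psi>)
  show ?case using Conj.IH[of e e'] Conj.prems by simp
next
  case (Neg \<phi>)
  show ?case using Neg.IH[of e e'] Neg.prems by simp
qed simp_all

text \<open>The map \<open>r\<close> need not be injective, so a bound variable could be captured;
  the quantifier case therefore binds a variable outside the image of the free variables.\<close>

lemma holds_rename:
  "\<exists>\<psi>. \<forall>e. holds mem e \<psi> \<longleftrightarrow> holds mem (\<lambda>n. e (r n)) \<phi>"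
proof (induction \<phi> arbitrary: r)
  case (Mem i j)
  show ?case by (rule exI[of _ "Mem (r i) (r j)"]) simp
next
  case (Eq i j)
  show ?case by (rule exI[of _ "Eq (r i) (r j)"]) simp
next
  case (Neg \<phi>)
  then obtain \<psi> where "\<forall>e. holds mem e \<psi> \<longleftrightarrow> holds mem (\<lambda>n. e (r n)) \<phi>" by blast
  then show ?case by (intro exI[of _ "Neg \<psi>"]) simp
next
  case (Conj \<phi>1 \<phi>2)
  from Conj(1)[of r] obtain \<psi>1 where "\<forall>e. holds mem e \<psi>1 \<longleftrightarrow> holds mem (\<lambda>n. e (r n)) \<phi>1" by blast
  moreover from Conj(2)[of r] obtain \<psi>2 where "\<forall>e. holds mem e \<psi>2 \<longleftrightarrow> holds mem (\<lambda>n. e (r n)) \<phi>2"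
    by blast
  ultimately show ?case by (intro exI[of _ "Conj \<psi>1 \<psi>2"]) simp
next
  case (All i \<phi>)
  obtain k where k: "k \<notin> r ` free_vars \<phi>"
    using ex_new_if_finite[OF infinite_UNIV_nat finite_imageI[OF finite_free_vars]] by metis
  from All[of "r(i := k)"] obtain \<psi>
    where \<psi>: "\<forall>e. holds mem e \<psi> \<longleftrightarrow> holds mem (\<lambda>n. e ((r(i := k)) n)) \<phi>" by blast
  have "holds mem (\<lambda>n. (e(k := x)) ((r(i := k)) n)) \<phi> \<longleftrightarrow> holds mem ((\<lambda>n. e (r n))(i := x)) \<phi>" for e x
    by (rule holds_cong) (use k in auto)
  then show ?case using \<psi> by (intro exI[of _ "All k \<psi>"]) simp
qed

text \<open>Interleaving leaves room for infinitely many variables and infinitely many parameters,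
  so either kind can be shifted without disturbing the other.\<close>

definition mix :: "(nat \<Rightarrow> 'v) \<Rightarrow> (nat \<Rightarrow> 'v) \<Rightarrow> nat \<Rightarrow> 'v" where
  "mix e p n = (if even n then e (n div 2) else p (n div 2))"

lemma mix_simps [simp]: "mix e p (2 * n) = e n" "mix e p (Suc (2 * n)) = p n"
  by (simp_all add: mix_def)

named_theorems fo_intros

context ZFC
begin

text \<open>
  Definability with parameters: the even variables of the formula carry the valuation \<open>e\<close>, the odd
  ones the parameters. In \<open>fot\<close>, variable \<open>0\<close> holds the value of the term, so that all other
  variables are shifted by one.
\<close>

definition fo :: "((nat \<Rightarrow> 'v) \<Rightarrow> bool) \<Rightarrow> bool" where
  "fo P \<longleftrightarrow> (\<exists>\<phi> p. \<forall>e. P e \<longleftrightarrow> holds mem (mix e p) \<phi>)"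

definition fot :: "((nat \<Rightarrow> 'v) \<Rightarrow> 'v) \<Rightarrow> bool" where
  "fot t \<longleftrightarrow> fo (\<lambda>e. e 0 = t (\<lambda>n. e (Suc n)))"

section \<open>Closure of definability under renaming, connectives and quantifiers\<close>

lemma fo_rename: assumes "fo P" shows "fo (\<lambda>e. P (\<lambda>n. e (r n)))"
proof -
  obtain \<phi> p where \<phi>: "\<And>e. P e \<longleftrightarrow> holds mem (mix e p) \<phi>" using assms unfolding fo_def by blast
  define r' where "r' n = (if even n then 2 * r (n div 2) else n)" for n
  obtain \<psi> where \<psi>: "\<And>e. holds mem e \<psi> \<longleftrightarrow> holds mem (\<lambda>n. e (r' n)) \<phi>"
    using holds_rename[of mem r' \<phi>] by auto
  have "(\<lambda>n. mix e p (r' n)) = mix (\<lambda>n. e (r n)) p" for e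
    by (auto simp: r'_def mix_def)
  then show ?thesis unfolding fo_def \<phi> using \<psi> by metis
qed

lemma fo_not [fo_intros]: assumes "fo P" shows "fo (\<lambda>e. \<not> P e)"
proof -
  obtain \<phi> p where "\<And>e. P e \<longleftrightarrow> holds mem (mix e p) \<phi>" using assms unfolding fo_def by blast
  then show ?thesis unfolding fo_def by (intro exI[of _ "Neg \<phi>"] exI[of _ p]) simp
qed

lemma fo_conj [fo_intros]: assumes "fo P" "fo Q" shows "fo (\<lambda>e. P e \<and> Q e)"
proof -
  obtain \<phi> p where \<phi>: "\<And>e. P e \<longleftrightarrow> holds mem (mix e p) \<phi>" using assms unfolding fo_def by blast
  obtain \<psi> q where \<psi>: "\<And>e. Q e \<longleftrightarrow> holds mem (mix e q) \<psi>" using assms unfolding fo_def by blast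
  \<comment> \<open>Both parameter sequences are stored in \<open>mix p q\<close>: parameter k of
    \<open>p\<close> moves to slot 2k, hence to variable 4k+1, and parameter k of \<open>q\<close>
    to slot 2k+1, hence to variable 4k+3.\<close>
  define r1 where "r1 n = (if even n then n else 4 * (n div 2) + 1)" for n :: nat
  define r2 where "r2 n = (if even n then n else 4 * (n div 2) + 3)" for n :: nat
  obtain \<phi>' where \<phi>': "\<And>e. holds mem e \<phi>' \<longleftrightarrow> holds mem (\<lambda>n. e (r1 n)) \<phi>"
    using holds_rename[of mem r1 \<phi>] by blast
  obtain \<psi>' where \<psi>': "\<And>e. holds mem e \<psi>' \<longleftrightarrow> holds mem (\<lambda>n. e (r2 n)) \<psi>"
    using holds_rename[of mem r2 \<psi>] by blast
  have "(\<lambda>n. mix e (mix p q) (r1 n)) = mix e p" for e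
  proof
    fix n show "mix e (mix p q) (r1 n) = mix e p n"
    proof (cases "even n")
      case False
      have "4 * (n div 2) + 1 = Suc (2 * (2 * (n div 2)))" by simp
      then have "mix e (mix p q) (r1 n) = p (n div 2)" using False unfolding r1_def
        by (metis mix_simps)
      then show ?thesis using False by (simp add: mix_def)
    qed (simp add: r1_def mix_def)
  qed
  moreover have "(\<lambda>n. mix e (mix p q) (r2 n)) = mix e q" for e
  proof
    fix n show "mix e (mix p q) (r2 n) = mix e q n"
    proof (cases "even n")
      case False
      have "4 * (n div 2) + 3 = Suc (2 * Suc (2 * (n div 2)))" by simp
      then have "mix e (mix p q) (r2 n) = q (n div 2)" using False unfolding r2_def
        by (metis mix_simps)
      then show ?thesis using False by (simp add: mix_def)
    qed (simp add: r2_def mix_def)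
  qed
  ultimately show ?thesis unfolding fo_def \<phi> \<psi>
    by (intro exI[of _ "Conj \<phi>' \<psi>'"] exI[of _ "mix p q"]) (simp add: \<phi>' \<psi>')
qed

lemma fo_all [fo_intros]: assumes "fo (\<lambda>e. Q (\<lambda>n. e (Suc n)) (e 0))" shows "fo (\<lambda>e. \<forall>x. Q e x)"
proof -
  obtain \<phi> p where \<phi>: "\<And>e. Q (\<lambda>n. e (Suc n)) (e 0) \<longleftrightarrow> holds mem (mix e p) \<phi>"
    using assms unfolding fo_def by blast
  \<comment> \<open>The parameters move up by one slot, which frees variable 1 for the quantifier;
    the remaining entries of the valuation move down by one.\<close>
  define r where "r n = (if n = 0 then 1 else if even n then n - 2 else n + 2)" for n :: nat
  obtain \<psi> where \<psi>: "\<And>e. holds mem e \<psi> \<longleftrightarrow> holds mem (\<lambda>n. e (r n)) \<phi>"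
    using holds_rename[of mem r \<phi>] by blast
  have "(\<lambda>n. ((mix e (case_nat undefined p))(1 := x)) (r n)) = mix (case_nat x e) p" for e x
  proof
    fix n show "((mix e (case_nat undefined p))(1 := x)) (r n) = mix (case_nat x e) p n"
    proof (cases "even n")
      case True
      then obtain k where k: "n = 2 * k" by blast
      show ?thesis unfolding k by (cases k) (auto simp: r_def mix_def)
    next
      case False
      then obtain k where k: "n = Suc (2 * k)" by (auto elim: oddE)
      have "r n = Suc (2 * Suc k)" unfolding k r_def by simp
      then show ?thesis unfolding k by (metis (no_types, lifting) One_nat_def Suc_inject fun_upd_apply mix_simps(2)
        mult_is_0 nat.distinct(1) old.nat.simps(5) zero_neq_numeral)
    qed
  qed
  then have "holds mem (mix e (case_nat undefined p)) (All 1 \<psi>) \<longleftrightarrow> (\<forall>x. Q e x)" for e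
    using \<phi>[of "case_nat _ e"] by (simp add: \<psi>)
  then show ?thesis unfolding fo_def by metis
qed

lemma fo_disj [fo_intros]: "fo P \<Longrightarrow> fo Q \<Longrightarrow> fo (\<lambda>e. P e \<or> Q e)"
  using fo_not[OF fo_conj[OF fo_not fo_not, of P Q]] by simp

lemma fo_imp [fo_intros]: "fo P \<Longrightarrow> fo Q \<Longrightarrow> fo (\<lambda>e. P e \<longrightarrow> Q e)"
  using fo_not[OF fo_conj[OF _ fo_not, of P Q]] by simp

lemma fo_iff [fo_intros]: "fo P \<Longrightarrow> fo Q \<Longrightarrow> fo (\<lambda>e. P e \<longleftrightarrow> Q e)"
  using fo_conj[OF fo_imp fo_imp, of P Q Q P] by (simp add: iff_conv_conj_imp)

lemma fo_ex [fo_intros]: "fo (\<lambda>e. Q (\<lambda>n. e (Suc n)) (e 0)) \<Longrightarrow> fo (\<lambda>e. \<exists>x. Q e x)"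
  using fo_not[OF fo_all[of "\<lambda>e x. \<not> Q e x"]] fo_not by simp

lemma fo_mem_var: "fo (\<lambda>e. e i \<epsilon> e j)"
  unfolding fo_def by (rule exI[of _ "Mem (2 * i) (2 * j)"]) simp

lemma fo_eq_var: "fo (\<lambda>e. e i = e j)"
  unfolding fo_def by (rule exI[of _ "Eq (2 * i) (2 * j)"]) simp

lemma fot_var [fo_intros]: "fot (\<lambda>e. e i)"
  unfolding fot_def by (rule fo_eq_var)

lemma fot_const [fo_intros]: "fot (\<lambda>e. c)"
  unfolding fot_def fo_def by (rule exI[of _ "Eq (2 * 0) (Suc (2 * 0))"], rule exI[of _ "\<lambda>_. c"])
    (simp only: holds.simps mix_simps, simp)

lemma fo_const [fo_intros]: "fo (\<lambda>e. b)"
proof (cases b)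
  case True
  then show ?thesis using fo_eq_var[of 0 0] by simp
next
  case False
  then show ?thesis using fo_not[OF fo_eq_var[of 0 0]] by simp
qed

lemma fo_ex1 [fo_intros]: assumes "fo (\<lambda>e. Q (\<lambda>n. e (Suc n)) (e 0))" shows "fo (\<lambda>e. \<exists>!x. Q e x)"
  unfolding Ex1_def
proof (intro fo_intros assms)
  show "fo (\<lambda>e. Q (\<lambda>n. e (Suc (Suc n))) (e 0))"
    using fo_rename[OF assms, of "\<lambda>n. case n of 0 \<Rightarrow> 0 | Suc m \<Rightarrow> Suc (Suc m)"] by simp
  show "fo (\<lambda>e. e 0 = e (Suc 0))" by (rule fo_eq_var)
qed

section \<open>Substitution of definable functions for variables\<close>

lemma fot_shift: assumes "fot t" shows "fot (\<lambda>e. t (\<lambda>n. e (Suc n)))"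
  using fo_rename[OF assms[unfolded fot_def], of "\<lambda>n. case n of 0 \<Rightarrow> 0 | Suc m \<Rightarrow> Suc (Suc m)"]
  unfolding fot_def by simp

text \<open>The language has no terms besides variables, so an atomic formula in definable functions
  is expressed by existential quantifiers over their values. Below a quantifier, variable 0 is the
  bound one and the other functions are shifted past it.\<close>

lemma fo_holds_subst:
  "(\<And>i. fot (ts i)) \<Longrightarrow> fo (\<lambda>e. holds mem (\<lambda>i. ts i e) \<phi>)"
proof (induction \<phi> arbitrary: ts)
  case (Mem i j)
  have "fo (\<lambda>e. \<exists>x. x = ts i e \<and> (\<exists>y. y = ts j e \<and> x \<epsilon> y))"
    by (intro fo_intros fo_mem_var Mem[unfolded fot_def] fot_shift[OF Mem, unfolded fot_def])
  then show ?case by simp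
next
  case (Eq i j)
  have "fo (\<lambda>e. \<exists>x. x = ts i e \<and> (\<exists>y. y = ts j e \<and> x = y))"
    by (intro fo_intros fo_eq_var Eq[unfolded fot_def] fot_shift[OF Eq, unfolded fot_def])
  then show ?case by simp
next
  case (All i \<phi>)
  define us where "us j = (if j = i then (\<lambda>e. e 0) else (\<lambda>e. ts j (\<lambda>n. e (Suc n))))" for j
  have "fot (us j)" for j
    unfolding us_def using fot_shift[OF All.prems] fot_var by simp
  then have "fo (\<lambda>e. holds mem (\<lambda>j. us j e) \<phi>)" by (rule All.IH)
  moreover have "(\<lambda>j. us j e) = (\<lambda>j. ts j (\<lambda>n. e (Suc n)))(i := e 0)" for e
    by (auto simp: us_def)
  ultimately show ?case using fo_all[of "\<lambda>e x. holds mem ((\<lambda>j. ts j e)(i := x)) \<phi>"] by simp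
qed (simp_all add: fo_intros)

lemma fo_subst: assumes "fo P" "\<And>i. fot (ts i)" shows "fo (\<lambda>e. P (\<lambda>i. ts i e))"
proof -
  obtain \<phi> p where \<phi>: "\<And>e. P e \<longleftrightarrow> holds mem (mix e p) \<phi>" using assms unfolding fo_def by blast
  define us where "us n = (if even n then ts (n div 2) else (\<lambda>e. p (n div 2)))" for n
  have "fot (us n)" for n unfolding us_def using assms(2) fot_const by simp
  moreover have "mix (\<lambda>i. ts i e) p = (\<lambda>i. us i e)" for e
    by (auto simp: mix_def us_def)
  ultimately show ?thesis unfolding \<phi> using fo_holds_subst[of us \<phi>] by simp
qed

text \<open>With this and its variants it suffices to check a notion at plain variables, by
  unfolding its definition; the rules in \<open>fo_intros\<close> then apply to arbitrary definable
  arguments.\<close>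

lemma fo_subst1: "fo (\<lambda>e. P (e 0)) \<Longrightarrow> fot s \<Longrightarrow> fo (\<lambda>e. P (s e))"
  using fo_subst[of "\<lambda>e. P (e 0)" "\<lambda>_. s"] by simp

lemma fo_subst2:
  assumes "fo (\<lambda>e. P (e 0) (e 1))" "fot s" "fot t" shows "fo (\<lambda>e. P (s e) (t e))"
  using fo_subst[of "\<lambda>e. P (e 0) (e 1)" "\<lambda>i. if i = 0 then s else t"] assms by simp

lemma fo_subst3:
  assumes "fo (\<lambda>e. P (e 0) (e 1) (e 2))" "fot s" "fot t" "fot u"
  shows "fo (\<lambda>e. P (s e) (t e) (u e))"
  using fo_subst[of "\<lambda>e. P (e 0) (e 1) (e 2)" "\<lambda>i. if i = 0 then s else if i = 1 then t else u"]
    assms by simp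

lemma fot_subst1:
  assumes "fo (\<lambda>e. e 0 = F (e 1))" "fot s" shows "fot (\<lambda>e. F (s e))"
  using fo_subst2[of "\<lambda>x y. x = F y", OF assms(1) fot_var[of 0] fot_shift[OF assms(2)]]
  by (simp add: fot_def)

lemma fot_subst2:
  assumes "fo (\<lambda>e. e 0 = F (e 1) (e 2))" "fot s" "fot t" shows "fot (\<lambda>e. F (s e) (t e))"
  using fo_subst3[of "\<lambda>x y z. x = F y z", OF assms(1) fot_var[of 0] fot_shift[OF assms(2)]
      fot_shift[OF assms(3)]]
  by (simp add: fot_def)

lemma fot_subst3:
  assumes "fo (\<lambda>e. e 0 = F (e 1) (e 2) (e 3))" "fot s" "fot t" "fot u"
  shows "fot (\<lambda>e. F (s e) (t e) (u e))"
  using fo_subst[of "\<lambda>e. e 0 = F (e 1) (e 2) (e 3)" "\<lambda>i. if i = 0 then (\<lambda>e. e 0) else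
     if i = 1 then (\<lambda>e. s (\<lambda>n. e (Suc n))) else if i = 2 then (\<lambda>e. t (\<lambda>n. e (Suc n)))
     else (\<lambda>e. u (\<lambda>n. e (Suc n)))"]
    assms fot_shift fot_var by (simp add: fot_def[of "\<lambda>e. F (s e) (t e) (u e)"])

lemma fo_mem [fo_intros]: "fot s \<Longrightarrow> fot t \<Longrightarrow> fo (\<lambda>e. s e \<epsilon> t e)"
  using fo_subst2[of "\<lambda>x y. x \<epsilon> y", OF fo_mem_var] .

lemma fo_eq [fo_intros]: "fot s \<Longrightarrow> fot t \<Longrightarrow> fo (\<lambda>e. s e = t e)"
  using fo_subst2[of "\<lambda>x y. x = y", OF fo_eq_var] .

section \<open>The axiom schemas for definable predicates\<close>

lemma separation_fo:
  assumes "fo (\<lambda>e. P (e 0))" shows "\<exists>b. \<forall>x. x \<epsilon> b \<longleftrightarrow> x \<epsilon> a \<and> P x"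
proof -
  obtain \<phi> p where \<phi>: "\<And>e. P (e 0) \<longleftrightarrow> holds mem (mix e p) \<phi>" using assms unfolding fo_def by blast
  have "(mix (\<lambda>_. undefined) p)(0 := x) = mix ((\<lambda>_. undefined)(0 := x)) p" for x
  proof
    fix n show "((mix (\<lambda>_. undefined) p)(0 := x)) n = mix ((\<lambda>_. undefined)(0 := x)) p n"
      by (cases "even n") (auto simp: mix_def)
  qed
  then show ?thesis
    using separation[of a "mix (\<lambda>_. undefined) p" \<phi>] \<phi>[of "(\<lambda>_. undefined)(0 := _)"] by simp
qed

lemma replacement_fo:
  assumes "fo (\<lambda>e. P (e 0) (e 1))"
    and "\<And>x y y'. x \<epsilon> a \<Longrightarrow> P x y \<Longrightarrow> P x y' \<Longrightarrow> y = y'"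
  shows "\<exists>b. \<forall>y. y \<epsilon> b \<longleftrightarrow> (\<exists>x. x \<epsilon> a \<and> P x y)"
proof -
  obtain \<phi> p where \<phi>: "\<And>e. P (e 0) (e 1) \<longleftrightarrow> holds mem (mix e p) \<phi>"
    using assms(1) unfolding fo_def by blast
  \<comment> \<open>Under \<open>mix\<close> the value \<open>y\<close> sits at position 2 and
    position 1 holds a parameter, while the axiom expects \<open>y\<close> at position 1; shifting
    the parameters vacates that position.\<close>
  define r where "r n = (if n = 2 then 1 else if even n then n else n + 2)" for n :: nat
  obtain \<psi> where \<psi>: "\<And>e. holds mem e \<psi> \<longleftrightarrow> holds mem (\<lambda>n. e (r n)) \<phi>"
    using holds_rename[of mem r \<phi>] by blast
  define E where "E = mix (\<lambda>_. undefined) (case_nat undefined p)"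
  have "(\<lambda>n. (E(0 := x, 1 := y)) (r n)) = mix ((\<lambda>_. undefined)(0 := x, 1 := y)) p" for x y
  proof
    fix n show "(E(0 := x, 1 := y)) (r n) = mix ((\<lambda>_. undefined)(0 := x, 1 := y)) p n"
    proof (cases "even n")
      case True
      then obtain k where k: "n = 2 * k" by blast
      show ?thesis unfolding k E_def by (auto simp: r_def mix_def)
    next
      case False
      then obtain k where k: "n = Suc (2 * k)" by (auto elim: oddE)
      have "r n = Suc (2 * Suc k)" unfolding k r_def by simp
      then show ?thesis unfolding k E_def by (simp add: mix_def)
    qed
  qed
  then have "holds mem (E(0 := x, 1 := y)) \<psi> \<longleftrightarrow> P x y" for x y
    using \<phi>[of "(\<lambda>_. undefined)(0 := x, 1 := y)"] by (simp add: \<psi>)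
  then show ?thesis using replacement[of a E \<psi>] assms(2) by simp blast
qed

section \<open>Basic set theory in the model\<close>

abbreviation the_set where "the_set \<equiv> Defs.the_set mem"
abbreviation sub where "sub \<equiv> Defs.sub mem"
abbreviation zero where "zero \<equiv> Defs.zero mem"
abbreviation succ where "succ \<equiv> Defs.succ mem"
abbreviation upair where "upair \<equiv> Defs.upair mem"
abbreviation pair where "pair \<equiv> Defs.pair mem"
abbreviation transitive where "transitive \<equiv> Defs.transitive mem"
abbreviation ordinal where "ordinal \<equiv> Defs.ordinal mem"
abbreviation natural where "natural \<equiv> Defs.natural mem"
abbreviation fun_from_to where "fun_from_to \<equiv> Defs.fun_from_to mem"
abbreviation app where "app \<equiv> Defs.app mem"
abbreviation extend where "extend \<equiv> Defs.extend mem"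

lemma set_eqI: "(\<And>z. z \<epsilon> x \<longleftrightarrow> z \<epsilon> y) \<Longrightarrow> x = y"
  using extensionality by blast

lemma mem_the_set: assumes "\<exists>x. \<forall>z. z \<epsilon> x \<longleftrightarrow> P z" shows "z \<epsilon> the_set P \<longleftrightarrow> P z"
proof -
  obtain x where x: "\<forall>z. z \<epsilon> x \<longleftrightarrow> P z" using assms by blast
  have "\<forall>z. z \<epsilon> the_set P \<longleftrightarrow> P z"
    unfolding the_set_def by (rule theI[of _ x]) (use x in \<open>auto intro: set_eqI\<close>)
  then show ?thesis by blast
qed

lemma mem_zero [simp]: "\<not> z \<epsilon> zero"
  using mem_the_set[of "\<lambda>z. False" z] separation_fo[of "\<lambda>_. False"]
  unfolding zero_def by (simp add: fo_intros)

lemma mem_upair [simp]: "z \<epsilon> upair x y \<longleftrightarrow> z = x \<or> z = y"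
  unfolding upair_def by (rule mem_the_set[OF pairing])

lemma upair_eq: "upair x y = upair u v \<longleftrightarrow> x = u \<and> y = v \<or> x = v \<and> y = u"
proof
  assume "upair x y = upair u v"
  then have "z = x \<or> z = y \<longleftrightarrow> z = u \<or> z = v" for z using mem_upair by metis
  then show "x = u \<and> y = v \<or> x = v \<and> y = u" by metis
qed (auto intro: set_eqI)

lemma pair_eq [simp]: "pair x y = pair u v \<longleftrightarrow> x = u \<and> y = v"
  unfolding pair_def upair_eq by blast

definition big_union :: "'v \<Rightarrow> 'v" where
  "big_union x = the_set (\<lambda>z. \<exists>y. y \<epsilon> x \<and> z \<epsilon> y)"

definition pow :: "'v \<Rightarrow> 'v" where
  "pow x = the_set (\<lambda>z. sub z x)"

definition cup :: "'v \<Rightarrow> 'v \<Rightarrow> 'v" where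
  "cup x y = big_union (upair x y)"

definition times :: "'v \<Rightarrow> 'v \<Rightarrow> 'v" where
  "times a b = the_set (\<lambda>z. \<exists>x y. x \<epsilon> a \<and> y \<epsilon> b \<and> z = pair x y)"

lemma mem_big_union [simp]: "z \<epsilon> big_union x \<longleftrightarrow> (\<exists>y. y \<epsilon> x \<and> z \<epsilon> y)"
  unfolding big_union_def by (rule mem_the_set[OF union])

lemma mem_pow [simp]: "z \<epsilon> pow x \<longleftrightarrow> sub z x"
  unfolding pow_def by (rule mem_the_set) (use power[of x] in \<open>simp add: sub_def\<close>)

lemma mem_cup [simp]: "z \<epsilon> cup x y \<longleftrightarrow> z \<epsilon> x \<or> z \<epsilon> y"
  unfolding cup_def by auto

lemma mem_succ [simp]: "z \<epsilon> succ x \<longleftrightarrow> z \<epsilon> x \<or> z = x"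
  unfolding succ_def by (rule mem_the_set, rule exI[of _ "cup x (upair x x)"]) simp

lemma separationE:
  assumes "fo (\<lambda>e. P (e 0))" obtains b where "\<And>x. x \<epsilon> b \<longleftrightarrow> x \<epsilon> a \<and> P x"
  using separation_fo[OF assms] by blast

lemma fo_sub [fo_intros]: "fot s \<Longrightarrow> fot t \<Longrightarrow> fo (\<lambda>e. sub (s e) (t e))"
  by (rule fo_subst2[of sub], unfold sub_def) (intro fo_intros)

lemma fot_upair [fo_intros]: "fot s \<Longrightarrow> fot t \<Longrightarrow> fot (\<lambda>e. upair (s e) (t e))"
proof (rule fot_subst2[of upair])
  have "x = upair y z \<longleftrightarrow> (\<forall>w. w \<epsilon> x \<longleftrightarrow> w = y \<or> w = z)" for x y z
    using set_eqI by auto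
  then show "fo (\<lambda>e. e 0 = upair (e 1) (e 2))" by (simp only:) (intro fo_intros)
qed

lemma fot_pair [fo_intros]: "fot s \<Longrightarrow> fot t \<Longrightarrow> fot (\<lambda>e. pair (s e) (t e))"
  unfolding pair_def by (intro fo_intros)

lemma fot_big_union [fo_intros]: "fot s \<Longrightarrow> fot (\<lambda>e. big_union (s e))"
proof (rule fot_subst1[of big_union])
  have "x = big_union y \<longleftrightarrow> (\<forall>w. w \<epsilon> x \<longleftrightarrow> (\<exists>v. v \<epsilon> y \<and> w \<epsilon> v))" for x y
    using set_eqI by auto
  then show "fo (\<lambda>e. e 0 = big_union (e 1))" by (simp only:) (intro fo_intros)
qed

lemma fot_pow [fo_intros]: "fot s \<Longrightarrow> fot (\<lambda>e. pow (s e))"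
proof (rule fot_subst1[of pow])
  have "x = pow y \<longleftrightarrow> (\<forall>w. w \<epsilon> x \<longleftrightarrow> sub w y)" for x y
    using set_eqI by auto
  then show "fo (\<lambda>e. e 0 = pow (e 1))" by (simp only:) (intro fo_intros)
qed

lemma fot_succ [fo_intros]: "fot s \<Longrightarrow> fot (\<lambda>e. succ (s e))"
proof (rule fot_subst1[of succ])
  have "x = succ y \<longleftrightarrow> (\<forall>w. w \<epsilon> x \<longleftrightarrow> w \<epsilon> y \<or> w = y)" for x y
    using set_eqI by auto
  then show "fo (\<lambda>e. e 0 = succ (e 1))" by (simp only:) (intro fo_intros)
qed

lemma mem_times: "z \<epsilon> times a b \<longleftrightarrow> (\<exists>x y. x \<epsilon> a \<and> y \<epsilon> b \<and> z = pair x y)"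
proof -
  obtain c where c: "\<And>z. z \<epsilon> c \<longleftrightarrow> z \<epsilon> pow (pow (cup a b)) \<and> (\<exists>x y. x \<epsilon> a \<and> y \<epsilon> b \<and> z = pair x y)"
    by (rule separationE[of "\<lambda>z. \<exists>x y. x \<epsilon> a \<and> y \<epsilon> b \<and> z = pair x y"], intro fo_intros, blast)
  have "pair x y \<epsilon> pow (pow (cup a b))" if "x \<epsilon> a" "y \<epsilon> b" for x y
    using that by (auto simp: pair_def sub_def)
  then show ?thesis unfolding times_def using c by (intro mem_the_set exI[of _ c]) blast
qed

lemma pair_mem_times [simp]: "pair x y \<epsilon> times a b \<longleftrightarrow> x \<epsilon> a \<and> y \<epsilon> b"
  by (auto simp: mem_times)

lemma replacement_fot:
  assumes "fot (\<lambda>e. F (e 0))" shows "\<exists>b. \<forall>y. y \<epsilon> b \<longleftrightarrow> (\<exists>x. x \<epsilon> a \<and> y = F x)"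
proof (rule replacement_fo)
  show "fo (\<lambda>e. e 1 = F (e 0))"
    using assms fo_subst2[of "\<lambda>x y. x = F y", OF _ fot_var[of 1] fot_var[of 0]]
    unfolding fot_def by simp
qed simp

lemma mem_irrefl [simp]: "\<not> x \<epsilon> x"
  using foundation[of "upair x x"] by auto

lemma mem_asym: "x \<epsilon> y \<Longrightarrow> \<not> y \<epsilon> x"
  using foundation[of "upair x y"] by auto

lemma mem_no_3_cycle: "x \<epsilon> y \<Longrightarrow> y \<epsilon> z \<Longrightarrow> \<not> z \<epsilon> x"
  using foundation[of "cup (upair x y) (upair z z)"] by auto

section \<open>Functions\<close>

lemma fo_fun_from_to [fo_intros]:
  "fot s \<Longrightarrow> fot t \<Longrightarrow> fot u \<Longrightarrow> fo (\<lambda>e. fun_from_to (s e) (t e) (u e))"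
  by (rule fo_subst3[of fun_from_to], unfold fun_from_to_def) (intro fo_intros)

lemma app_eqI: "fun_from_to f d c \<Longrightarrow> pair x y \<epsilon> f \<Longrightarrow> app f x = y"
  unfolding fun_from_to_def app_def by (rule the_equality) (fastforce+)

lemma fun_app:
  assumes "fun_from_to f d c" "x \<epsilon> d"
  shows "pair x (app f x) \<epsilon> f" "app f x \<epsilon> c"
proof -
  obtain y where y: "pair x y \<epsilon> f" using assms unfolding fun_from_to_def by blast
  show p: "pair x (app f x) \<epsilon> f" using app_eqI[OF assms(1) y] y by simp
  show "app f x \<epsilon> c" using p assms unfolding fun_from_to_def by (metis pair_eq)
qed

lemma fun_dom: "fun_from_to f d c \<Longrightarrow> pair x y \<epsilon> f \<Longrightarrow> x \<epsilon> d"
  unfolding fun_from_to_def by (metis pair_eq)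

lemma fun_pair_iff: "fun_from_to f d c \<Longrightarrow> pair x y \<epsilon> f \<longleftrightarrow> x \<epsilon> d \<and> y = app f x"
  using app_eqI fun_app fun_dom by metis

lemma fun_mem: "fun_from_to f d c \<Longrightarrow> z \<epsilon> f \<longleftrightarrow> (\<exists>x. x \<epsilon> d \<and> z = pair x (app f x))"
  using fun_pair_iff[of f d c] unfolding fun_from_to_def[of _ f d c] by auto

lemma fun_dom_unique: "fun_from_to f d c \<Longrightarrow> fun_from_to f d' c' \<Longrightarrow> d = d'"
  by (rule set_eqI) (metis fun_app(1) fun_dom)

lemma fun_codomI:
  "fun_from_to f d c \<Longrightarrow> (\<And>x. x \<epsilon> d \<Longrightarrow> app f x \<epsilon> c') \<Longrightarrow> fun_from_to f d c'"
  unfolding fun_from_to_def[of _ _ _ c'] using fun_mem[of f d c] fun_pair_iff[of f d c] by auto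

lemma fun_mono: "fun_from_to f d c \<Longrightarrow> sub c c' \<Longrightarrow> fun_from_to f d c'"
  using fun_codomI fun_app(2) unfolding sub_def by metis

lemma lam_ex:
  assumes "fot (\<lambda>e. F (e 0))" "\<And>x. x \<epsilon> a \<Longrightarrow> F x \<epsilon> c"
  shows "\<exists>f. fun_from_to f a c \<and> (\<forall>x. x \<epsilon> a \<longrightarrow> app f x = F x)"
proof -
  have "fot (\<lambda>e. pair (e 0) (F (e 0)))"
    by (intro fo_intros assms)
  then obtain f where f: "\<And>z. z \<epsilon> f \<longleftrightarrow> (\<exists>x. x \<epsilon> a \<and> z = pair x (F x))"
    using replacement_fot[of "\<lambda>x. pair x (F x)" a] by blast
  have f': "fun_from_to f a c" unfolding fun_from_to_def using f assms(2) by auto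
  then show ?thesis using app_eqI[OF f'] f by blast
qed

text \<open>Since \<open>app f x\<close> is a definite description, it is only first-order definable where \<open>f\<close> is
  single-valued; \<open>ap\<close> is a total variant.\<close>

definition ap :: "'v \<Rightarrow> 'v \<Rightarrow> 'v" where
  "ap f x = (if \<exists>!y. pair x y \<epsilon> f then app f x else zero)"

lemma ap_eq: "fun_from_to f d c \<Longrightarrow> x \<epsilon> d \<Longrightarrow> ap f x = app f x"
  unfolding ap_def fun_from_to_def by simp

lemma fot_ap [fo_intros]: "fot s \<Longrightarrow> fot t \<Longrightarrow> fot (\<lambda>e. ap (s e) (t e))"
proof (rule fot_subst2[of ap])
  have "z = ap f x \<longleftrightarrow> (\<exists>!y. pair x y \<epsilon> f) \<and> pair x z \<epsilon> f \<or> \<not> (\<exists>!y. pair x y \<epsilon> f) \<and> z = zero"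
    for f x z
    unfolding ap_def app_def using theI'[of "\<lambda>y. pair x y \<epsilon> f"] the1_equality[of "\<lambda>y. pair x y \<epsilon> f"]
    by (smt (verit))
  then show "fo (\<lambda>e. e 0 = ap (e 1) (e 2))" by (simp only:) (intro fo_intros)
qed

lemma mem_extend [simp]: "z \<epsilon> extend s n a \<longleftrightarrow> z \<epsilon> s \<or> z = pair n a"
  unfolding extend_def
  by (rule mem_the_set, rule exI[of _ "cup s (upair (pair n a) (pair n a))"]) simp

lemma fot_extend [fo_intros]: "fot s \<Longrightarrow> fot t \<Longrightarrow> fot u \<Longrightarrow> fot (\<lambda>e. extend (s e) (t e) (u e))"
proof (rule fot_subst3[of extend])
  have "x = extend s n a \<longleftrightarrow> (\<forall>w. w \<epsilon> x \<longleftrightarrow> w \<epsilon> s \<or> w = pair n a)" for x s n a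
    using set_eqI by auto
  then show "fo (\<lambda>e. e 0 = extend (e 1) (e 2) (e 3))" by (simp only:) (intro fo_intros)
qed

lemma fun_extend:
  assumes "fun_from_to s n M" "a \<epsilon> M" shows "fun_from_to (extend s n a) (succ n) M"
  unfolding fun_from_to_def
proof (intro conjI allI impI)
  fix z assume "z \<epsilon> extend s n a"
  then show "\<exists>x y. x \<epsilon> succ n \<and> y \<epsilon> M \<and> z = pair x y"
    using fun_mem[OF assms(1)] fun_app(2)[OF assms(1)] assms(2) by auto
next
  fix x assume "x \<epsilon> succ n"
  then show "\<exists>!y. pair x y \<epsilon> extend s n a"
    using fun_pair_iff[OF assms(1)] by auto
qed

lemma app_extend [simp]:
  assumes "fun_from_to s n M" "a \<epsilon> M"
  shows "app (extend s n a) n = a" "i \<epsilon> n \<Longrightarrow> app (extend s n a) i = app s i"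
  using app_eqI[OF fun_extend[OF assms]] fun_app[OF assms(1)] by auto

section \<open>Ordinals and natural numbers\<close>

lemma fo_transitive [fo_intros]: "fot s \<Longrightarrow> fo (\<lambda>e. transitive (s e))"
  by (rule fo_subst1[of transitive], unfold transitive_def) (intro fo_intros)

lemma fo_ordinal [fo_intros]: "fot s \<Longrightarrow> fo (\<lambda>e. ordinal (s e))"
  by (rule fo_subst1[of ordinal], unfold ordinal_def) (intro fo_intros)

lemma fo_natural [fo_intros]: "fot s \<Longrightarrow> fo (\<lambda>e. natural (s e))"
  by (rule fo_subst1[of natural], unfold natural_def) (intro fo_intros)

lemma transitiveD: "transitive x \<Longrightarrow> y \<epsilon> x \<Longrightarrow> z \<epsilon> y \<Longrightarrow> z \<epsilon> x"
  unfolding transitive_def sub_def by blast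

text \<open>Foundation supplies the minimal elements that the definition of \<open>ordinal\<close>
  asks for.\<close>

lemma ordinal_iff:
  "ordinal x \<longleftrightarrow> transitive x \<and> (\<forall>y z. y \<epsilon> x \<and> z \<epsilon> x \<longrightarrow> y \<epsilon> z \<or> y = z \<or> z \<epsilon> y)"
proof -
  have "\<exists>m. m \<epsilon> s \<and> (\<forall>y. y \<epsilon> s \<longrightarrow> \<not> y \<epsilon> m)" if "\<exists>y. y \<epsilon> s" for s
    using foundation[OF that] by blast
  then have A: "(\<forall>s. sub s x \<and> (\<exists>y. y \<epsilon> s) \<longrightarrow> (\<exists>m. m \<epsilon> s \<and> (\<forall>y. y \<epsilon> s \<longrightarrow> \<not> y \<epsilon> m))) = True" by blast
  show ?thesis unfolding ordinal_def A simp_thms ..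
qed

lemma ordinal_trans: "ordinal x \<Longrightarrow> y \<epsilon> x \<Longrightarrow> z \<epsilon> y \<Longrightarrow> z \<epsilon> x"
  unfolding ordinal_iff using transitiveD by blast

lemma ordinal_mem: assumes "ordinal x" "y \<epsilon> x" shows "ordinal y"
  unfolding ordinal_iff transitive_def sub_def
proof (intro conjI allI impI)
  fix z w assume "z \<epsilon> y" "w \<epsilon> z"
  moreover from this have "w \<epsilon> x" using assms ordinal_trans by blast
  ultimately show "w \<epsilon> y" using assms unfolding ordinal_iff by (metis mem_asym mem_no_3_cycle)
next
  fix z w assume "z \<epsilon> y \<and> w \<epsilon> y"
  then show "z \<epsilon> w \<or> z = w \<or> w \<epsilon> z" using assms ordinal_trans unfolding ordinal_iff by meson
qed

text \<open>An \<in>-minimal element of \<open>b\<close> outside \<open>a\<close> turns out to have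
  exactly the elements of \<open>a\<close>.\<close>

lemma ordinal_subset_mem:
  assumes "ordinal a" "ordinal b" "sub a b" "a \<noteq> b" shows "a \<epsilon> b"
proof -
  obtain c where c: "\<And>x. x \<epsilon> c \<longleftrightarrow> x \<epsilon> b \<and> \<not> x \<epsilon> a"
    by (rule separationE[of "\<lambda>x. \<not> x \<epsilon> a" b], intro fo_intros, blast)
  have "\<exists>x. x \<epsilon> c" using assms c unfolding sub_def by (metis set_eqI)
  then obtain m where m: "m \<epsilon> c" "\<And>z. z \<epsilon> c \<Longrightarrow> \<not> z \<epsilon> m" using foundation[of c] by blast
  have "m = a"
  proof (rule set_eqI)
    fix z show "z \<epsilon> m \<longleftrightarrow> z \<epsilon> a"
    proof
      assume "z \<epsilon> m"
      then show "z \<epsilon> a" using m c ordinal_trans[OF assms(2)] by blast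
    next
      assume z: "z \<epsilon> a"
      then have "z \<epsilon> b" using assms unfolding sub_def by blast
      then have "z \<epsilon> m \<or> z = m \<or> m \<epsilon> z" using assms m(1) c unfolding ordinal_iff by blast
      then show "z \<epsilon> m" using z m(1) c ordinal_trans[OF assms(1)] by blast
    qed
  qed
  then show ?thesis using m c by blast
qed

text \<open>The intersection of the two is an ordinal. If it differed from both, it would belong to
  both and hence to itself.\<close>

lemma ordinal_linear: assumes "ordinal a" "ordinal b" shows "a \<epsilon> b \<or> a = b \<or> b \<epsilon> a"
proof -
  obtain c where c: "\<And>x. x \<epsilon> c \<longleftrightarrow> x \<epsilon> a \<and> x \<epsilon> b"
    by (rule separationE[of "\<lambda>x. x \<epsilon> b" a], intro fo_intros, blast)
  have "ordinal c"
    using assms unfolding ordinal_iff transitive_def sub_def by (metis c)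
  moreover have "sub c a" "sub c b" unfolding sub_def using c by auto
  ultimately have "c = a \<or> c \<epsilon> a" "c = b \<or> c \<epsilon> b" using assms ordinal_subset_mem by blast+
  then show ?thesis using c[of c] mem_irrefl[of c] by metis
qed

lemma ordinalI: "transitive x \<Longrightarrow> (\<And>y. y \<epsilon> x \<Longrightarrow> ordinal y) \<Longrightarrow> ordinal x"
  by (simp add: ordinal_iff[of x] ordinal_linear)

lemma ordinal_succ: "ordinal x \<Longrightarrow> ordinal (succ x)"
  by (rule ordinalI) (auto simp: transitive_def sub_def ordinal_mem dest: ordinal_trans)

lemma ordinal_zero [simp]: "ordinal zero"
  by (rule ordinalI) (auto simp: transitive_def)

lemma ordinal_sub_iff: "ordinal a \<Longrightarrow> ordinal b \<Longrightarrow> sub a b \<longleftrightarrow> a \<epsilon> succ b"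
  unfolding mem_succ using ordinal_subset_mem ordinal_trans unfolding sub_def by blast

text \<open>The counterexamples up to \<open>a\<close> form a set only by separation, which is where
  definability of \<open>P\<close> enters; foundation then yields a minimal one.\<close>

lemma ordinal_induct [consumes 1, case_names fo step]:
  assumes "ordinal a" "fo (\<lambda>e. P (e 0))"
    and step: "\<And>b. ordinal b \<Longrightarrow> (\<And>c. c \<epsilon> b \<Longrightarrow> P c) \<Longrightarrow> P b"
  shows "P a"
proof (rule ccontr)
  assume "\<not> P a"
  obtain c where c: "\<And>x. x \<epsilon> c \<longleftrightarrow> x \<epsilon> succ a \<and> \<not> P x"
    using separation_fo[of "\<lambda>x. \<not> P x" "succ a"] assms(2) fo_not by blast
  have "\<exists>x. x \<epsilon> c" using \<open>\<not> P a\<close> c by auto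
  then obtain m where m: "m \<epsilon> c" "\<And>z. z \<epsilon> c \<Longrightarrow> \<not> z \<epsilon> m" using foundation[of c] by blast
  have o: "ordinal (succ a)" using assms(1) by (rule ordinal_succ)
  have "P m"
  proof (rule step)
    show "ordinal m" using m(1) c o ordinal_mem by blast
    show "P z" if "z \<epsilon> m" for z using that m c ordinal_trans[OF o] by blast
  qed
  then show False using m(1) c by blast
qed

section \<open>The natural numbers of the model, possibly nonstandard\<close>

lemma natural_ordinal: "natural n \<Longrightarrow> ordinal n"
  unfolding natural_def by blast

lemma natural_mem: "natural n \<Longrightarrow> m \<epsilon> n \<Longrightarrow> natural m"
  unfolding natural_def by (meson ordinal_mem ordinal_trans)

lemma natural_zero [simp]: "natural zero"
  unfolding natural_def by auto

lemma natural_succ [simp]: "natural n \<Longrightarrow> natural (succ n)"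
  unfolding natural_def using ordinal_succ by auto

lemma natural_induct [consumes 1, case_names fo zero succ]:
  assumes "natural n" "fo (\<lambda>e. P (e 0))"
    and "P zero" "\<And>k. natural k \<Longrightarrow> P k \<Longrightarrow> P (succ k)"
  shows "P n"
proof -
  have "ordinal n" using assms(1) by (rule natural_ordinal)
  then have "natural n \<longrightarrow> P n"
  proof (induction rule: ordinal_induct[where P = "\<lambda>n. natural n \<longrightarrow> P n"])
    case fo
    show ?case using assms(2) by (intro fo_intros)
  next
    case (step b)
    show ?case
    proof
      assume b: "natural b"
      then have "b = zero \<or> (\<exists>k. b = succ k)" unfolding natural_def by blast
      then show "P b" using assms(3,4) step b natural_mem by (metis mem_succ)
    qed
  qed
  then show ?thesis using assms(1) by blast
qed

lemma omega_ex: "\<exists>w. \<forall>n. n \<epsilon> w \<longleftrightarrow> natural n"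
proof -
  obtain w where w: "\<exists>z. z \<epsilon> w \<and> (\<forall>y. \<not> y \<epsilon> z)"
    "\<And>x. x \<epsilon> w \<Longrightarrow> \<exists>y. y \<epsilon> w \<and> (\<forall>z. z \<epsilon> y \<longleftrightarrow> z \<epsilon> x \<or> z = x)"
    using infinity by blast
  have z: "zero \<epsilon> w" using w(1) set_eqI[of zero] by (metis mem_zero)
  have s: "succ x \<epsilon> w" if "x \<epsilon> w" for x using w(2)[OF that] set_eqI[of "succ x"] by (metis mem_succ)
  have "n \<epsilon> w" if "natural n" for n
    using that by (induction rule: natural_induct) (auto intro: z s fo_intros)
  moreover obtain v where "\<And>n. n \<epsilon> v \<longleftrightarrow> n \<epsilon> w \<and> natural n"
    by (rule separationE[of natural w], intro fo_intros, blast)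
  ultimately show ?thesis by metis
qed

definition omega :: 'v where "omega = the_set natural"

lemma mem_omega [simp]: "n \<epsilon> omega \<longleftrightarrow> natural n"
  unfolding omega_def by (rule mem_the_set[OF omega_ex])

lemma ordinal_omega [simp]: "ordinal omega"
  by (rule ordinalI) (auto simp: transitive_def sub_def natural_ordinal natural_mem)

section \<open>Recursion along the ordinals\<close>

context
  fixes K :: "'v \<Rightarrow> 'v" and x0 :: 'v
  assumes fot_var_K: "fot (\<lambda>e. K (e 0))"
begin

lemma fot_K: "fot s \<Longrightarrow> fot (\<lambda>e. K (s e))"
  using fot_subst1[of K] fot_var_K unfolding fot_def by simp

text \<open>Initial segments of the recursion in which stage a is the union of \<open>x0\<close> and
  of all K(stage c) with c below a. It is used twice: with unions, started at a given set, for
  transitive closures, and with power sets, started at the empty set, for the cumulative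
  hierarchy.\<close>

definition approx :: "'v \<Rightarrow> 'v \<Rightarrow> bool" where
  "approx h a \<longleftrightarrow> ordinal a \<and> (\<exists>c. fun_from_to h (succ a) c) \<and>
     (\<forall>b. b \<epsilon> succ a \<longrightarrow> (\<forall>z. z \<epsilon> ap h b \<longleftrightarrow> z \<epsilon> x0 \<or> (\<exists>c. c \<epsilon> b \<and> z \<epsilon> K (ap h c))))"

definition stage :: "'v \<Rightarrow> 'v" where
  "stage a = (THE v. \<exists>h. approx h a \<and> v = ap h a)"

lemma fo_approx [fo_intros]: "fot s \<Longrightarrow> fot t \<Longrightarrow> fo (\<lambda>e. approx (s e) (t e))"
  by (rule fo_subst2[of approx], unfold approx_def) (intro fo_intros fot_K)

lemma approx_mem:
  "approx h a \<Longrightarrow> b \<epsilon> succ a \<Longrightarrow> z \<epsilon> ap h b \<longleftrightarrow> z \<epsilon> x0 \<or> (\<exists>c. c \<epsilon> b \<and> z \<epsilon> K (ap h c))"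
  unfolding approx_def by blast

lemma approx_unique:
  assumes h: "approx h a" "approx h' a'" and c: "c \<epsilon> succ a" "c \<epsilon> succ a'"
  shows "ap h c = ap h' c"
proof -
  have oa: "ordinal (succ a)" "ordinal (succ a')"
    using h ordinal_succ unfolding approx_def by blast+
  have "ordinal c" using oa c ordinal_mem by blast
  then have "c \<epsilon> succ a \<longrightarrow> c \<epsilon> succ a' \<longrightarrow> ap h c = ap h' c"
  proof (induction rule: ordinal_induct[where P = "\<lambda>c. c \<epsilon> succ a \<longrightarrow> c \<epsilon> succ a' \<longrightarrow> ap h c = ap h' c"])
    case fo
    show ?case by (intro fo_intros)
  next
    case (step b)
    show ?case
    proof (intro impI set_eqI)
      fix z assume b: "b \<epsilon> succ a" "b \<epsilon> succ a'"
      have "ap h d = ap h' d" if "d \<epsilon> b" for d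
        using step(2)[OF that] ordinal_trans[OF oa(1) b(1) that] ordinal_trans[OF oa(2) b(2) that]
        by blast
      then show "z \<epsilon> ap h b \<longleftrightarrow> z \<epsilon> ap h' b"
        unfolding approx_mem[OF h(1) b(1)] approx_mem[OF h(2) b(2)] by metis
    qed
  qed
  then show ?thesis using c by blast
qed

lemma approx_ex: "ordinal a \<Longrightarrow> \<exists>h. approx h a"
proof (induction rule: ordinal_induct)
  case fo
  show ?case by (intro fo_intros)
next
  case (step b)
  obtain H where H: "\<And>c. c \<epsilon> b \<Longrightarrow> approx (H c) c" using step(2) by metis
  define v where "v c = ap (H c) c" for c
  have v: "ap h c = v c" if "approx h a" "c \<epsilon> b" "c \<epsilon> succ a" for h a c
    unfolding v_def using approx_unique[OF that(1) H[OF that(2)] that(3)] by simp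
  \<comment> \<open>The functions \<open>H c\<close> were selected outside the model and need not
    depend definably on \<open>c\<close>. By uniqueness any approximation gives the same value, and
    this description is first-order, so replacement applies to it.\<close>
  have v_iff: "y = v c \<longleftrightarrow> (\<exists>h. approx h c \<and> y = ap h c)" if "c \<epsilon> b" for c y
  proof
    assume "y = v c"
    then show "\<exists>h. approx h c \<and> y = ap h c" using H[OF that] v_def by blast
  next
    assume "\<exists>h. approx h c \<and> y = ap h c"
    then obtain h where "approx h c" "y = ap h c" by blast
    then show "y = v c" using v[of h c c] that by simp
  qed
  have "\<exists>d. \<forall>y. y \<epsilon> d \<longleftrightarrow> (\<exists>c. c \<epsilon> b \<and> (\<exists>h. approx h c \<and> y = ap h c))"
    by (rule replacement_fo, intro fo_intros) (metis v_iff)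
  then obtain d where d: "\<And>y. y \<epsilon> d \<longleftrightarrow> (\<exists>c. c \<epsilon> b \<and> y = v c)" using v_iff by metis
  have "\<exists>g. \<forall>y. y \<epsilon> g \<longleftrightarrow> (\<exists>c. c \<epsilon> b \<and> (\<exists>h. approx h c \<and> y = pair c (ap h c)))"
    by (rule replacement_fo, intro fo_intros) (metis v_iff)
  then obtain g where g: "\<And>y. y \<epsilon> g \<longleftrightarrow> (\<exists>c. c \<epsilon> b \<and> y = pair c (v c))"
    using v_iff by metis
  obtain k where k: "\<And>y. y \<epsilon> k \<longleftrightarrow> (\<exists>x. x \<epsilon> d \<and> y = K x)"
    using replacement_fot[of K d, OF fot_K[OF fot_var]] by blast
  define U where "U = cup x0 (big_union k)"
  define h where "h = extend g b U"
  have "fun_from_to g b d" unfolding fun_from_to_def using g d by auto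
  then have "fun_from_to g b (cup d (upair U U))"
    by (rule fun_mono) (simp add: sub_def)
  note g_fun = this
  have h_fun: "fun_from_to h (succ b) (cup d (upair U U))"
    unfolding h_def by (rule fun_extend[OF g_fun]) simp
  have h_b: "ap h b = U"
    using ap_eq[OF h_fun] app_extend(1)[OF g_fun] unfolding h_def by simp
  have h_c: "ap h c = v c" if "c \<epsilon> b" for c
  proof -
    have "ap h c = app h c" using ap_eq[OF h_fun] that by simp
    also have "\<dots> = app g c" unfolding h_def using app_extend(2)[OF g_fun _ that] by simp
    also have "\<dots> = v c" using app_eqI[OF g_fun] g that by blast
    finally show ?thesis .
  qed
  have "approx h b" unfolding approx_def
  proof (intro conjI allI impI)
    fix c z assume "c \<epsilon> succ b"
    then consider "c = b" | "c \<epsilon> b" by auto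
    then show "z \<epsilon> ap h c \<longleftrightarrow> z \<epsilon> x0 \<or> (\<exists>d. d \<epsilon> c \<and> z \<epsilon> K (ap h d))"
    proof cases
      case 1
      have "z \<epsilon> big_union k \<longleftrightarrow> (\<exists>d. d \<epsilon> b \<and> z \<epsilon> K (v d))" using k d by auto
      then show ?thesis using 1 h_b h_c unfolding U_def by auto
    next
      case 2
      have "ap (H c) d = ap h d" if "d \<epsilon> c" for d
        using h_c v[OF H[OF 2]] that 2 ordinal_trans[OF step(1)] by auto
      then have "z \<epsilon> ap (H c) c \<longleftrightarrow> z \<epsilon> x0 \<or> (\<exists>d. d \<epsilon> c \<and> z \<epsilon> K (ap h d))"
        using approx_mem[OF H[OF 2], of c z] by auto
      then show ?thesis using h_c[OF 2] unfolding v_def by simp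
    qed
  qed (use step(1) h_fun in blast)+
  then show ?case by blast
qed

lemma approx_stage: assumes "approx h a" "c \<epsilon> succ a" shows "ap h c = stage c"
proof -
  have "ordinal c" using assms ordinal_succ ordinal_mem unfolding approx_def by blast
  then obtain h' where h': "approx h' c" using approx_ex by blast
  have "stage c = ap h' c"
    unfolding stage_def
  proof (rule the_equality)
    show "\<exists>h. approx h c \<and> ap h' c = ap h c" using h' by blast
    show "v = ap h' c" if "\<exists>h. approx h c \<and> v = ap h c" for v
      using that approx_unique[OF _ h', of _ c c] by auto
  qed
  then show ?thesis using approx_unique[OF assms(1) h' assms(2)] by simp
qed

lemma stage_iff: "ordinal a \<Longrightarrow> v = stage a \<longleftrightarrow> (\<exists>h. approx h a \<and> v = ap h a)"
  using approx_ex[of a] approx_stage[of _ a a] by auto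

lemma mem_stage:
  assumes "ordinal a" shows "z \<epsilon> stage a \<longleftrightarrow> z \<epsilon> x0 \<or> (\<exists>c. c \<epsilon> a \<and> z \<epsilon> K (stage c))"
proof -
  obtain h where h: "approx h a" using approx_ex[OF assms] by blast
  have "ap h c = stage c" if "c \<epsilon> a" for c using approx_stage[OF h] that by simp
  moreover have "ap h a = stage a" using approx_stage[OF h] by simp
  ultimately show ?thesis using approx_mem[OF h, of a z] by auto
qed

end

section \<open>Transitive closures\<close>

text \<open>Unions are iterated along \<open>omega\<close>: a member of the limit stage already
  occurs at some natural stage, so its elements enter with the next union and stay in the limit.
  This makes the intersection that defines \<open>trcl\<close> a set.\<close>

lemma transitive_superset_ex: "\<exists>t. transitive t \<and> sub x t"
proof -
  let ?t = "stage big_union x"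
  note mem = mem_stage[of big_union, OF fot_big_union[OF fot_var]]
  have "transitive (?t omega)" unfolding transitive_def sub_def
  proof (intro allI impI)
    fix y z assume "y \<epsilon> ?t omega" "z \<epsilon> y"
    then consider "y \<epsilon> x" | n where "natural n" "y \<epsilon> big_union (?t n)"
      using mem[OF ordinal_omega, of y x] by auto
    then have "\<exists>n. natural n \<and> y \<epsilon> ?t n"
    proof cases
      case 1
      then show ?thesis using mem[OF ordinal_zero, of y x] natural_zero by blast
    next
      case 2
      then have "y \<epsilon> ?t (succ n)"
        using mem[OF ordinal_succ[OF natural_ordinal], of n y x] by auto
      then show ?thesis using 2 natural_succ by blast
    qed
    then show "z \<epsilon> ?t omega" using mem[OF ordinal_omega, of z x] \<open>z \<epsilon> y\<close> by auto
  qed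
  moreover have "sub x (?t omega)" unfolding sub_def using mem[OF ordinal_omega, of _ x] by blast
  ultimately show ?thesis by blast
qed

lemma mem_trcl: "z \<epsilon> trcl mem x \<longleftrightarrow> (\<forall>t. transitive t \<and> sub x t \<longrightarrow> z \<epsilon> t)"
proof -
  obtain t where t: "transitive t" "sub x t" using transitive_superset_ex by blast
  obtain b where "\<And>z. z \<epsilon> b \<longleftrightarrow> z \<epsilon> t \<and> (\<forall>t. transitive t \<and> sub x t \<longrightarrow> z \<epsilon> t)"
    by (rule separationE[of "\<lambda>z. \<forall>t. transitive t \<and> sub x t \<longrightarrow> z \<epsilon> t" t], intro fo_intros, blast)
  then show ?thesis unfolding trcl_def
    by (intro mem_the_set exI[of _ b]) (use t in blast)
qed

lemma transitive_trcl: "transitive (trcl mem x)"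
  unfolding transitive_def sub_def mem_trcl using transitiveD by blast

section \<open>The cumulative hierarchy\<close>

abbreviation V where "V \<equiv> Defs.V mem"

text \<open>Identifies the hierarchy with the power set instance of the recursion. As
  \<open>h\<close> is a function on the transitive set \<open>succ a\<close>, its values under
  \<open>app\<close> and \<open>ap\<close> agree wherever they are used, and the version with
  \<open>ap\<close> is visibly first-order.\<close>

lemma V_iff: assumes "ordinal a" shows "v = V a \<longleftrightarrow> (\<exists>h. approx pow zero h a \<and> v = ap h a)"
proof -
  define A where "A h v \<longleftrightarrow> (\<forall>b. b \<epsilon> succ a \<longrightarrow> (\<forall>x. x \<epsilon> app h b \<longleftrightarrow> (\<exists>d. d \<epsilon> b \<and> sub x (app h d)))) \<and>
    v = app h a" for h v
  define B where "B h v \<longleftrightarrow> (\<forall>b. b \<epsilon> succ a \<longrightarrow> (\<forall>x. x \<epsilon> ap h b \<longleftrightarrow> (\<exists>d. d \<epsilon> b \<and> sub x (ap h d)))) \<and>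
    v = ap h a" for h v
  have "A h v \<longleftrightarrow> B h v" if h: "fun_from_to h (succ a) c" for h c v
  proof -
    have e: "ap h b = app h b" "d \<epsilon> b \<Longrightarrow> ap h d = app h d" if "b \<epsilon> succ a" for b d
      using that ap_eq[OF h] ordinal_trans[OF ordinal_succ[OF assms] that] by blast+
    have 1: "(\<forall>x. x \<epsilon> app h b \<longleftrightarrow> (\<exists>d. d \<epsilon> b \<and> sub x (app h d))) \<longleftrightarrow>
        (\<forall>x. x \<epsilon> ap h b \<longleftrightarrow> (\<exists>d. d \<epsilon> b \<and> sub x (ap h d)))" if "b \<epsilon> succ a" for b
      using e[OF that] by (simp cong: conj_cong)
    have 2: "ap h a = app h a" using e(1)[of a] by simp
    show ?thesis unfolding A_def B_def 2 by (simp only: 1 cong: imp_cong)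
  qed
  moreover have "approx pow zero h a \<and> v = ap h a \<longleftrightarrow> (\<exists>c. fun_from_to h (succ a) c) \<and> B h v" for h v
    unfolding approx_def[of pow, OF fot_pow[OF fot_var]] B_def using assms by simp
  ultimately have "(\<exists>h c. fun_from_to h (succ a) c \<and> A h v) \<longleftrightarrow>
     (\<exists>h. approx pow zero h a \<and> v = ap h a)" for v
    by metis
  then have "V a = stage pow zero a"
    unfolding V_def stage_def[of pow, OF fot_pow[OF fot_var]] by (simp add: A_def)
  then show ?thesis using stage_iff[of pow a v zero, OF fot_pow[OF fot_var] assms] by simp
qed

lemma mem_V: assumes "ordinal a" shows "x \<epsilon> V a \<longleftrightarrow> (\<exists>c. c \<epsilon> a \<and> sub x (V c))"
proof -
  have "V c = stage pow zero c" if "ordinal c" for c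
    using V_iff[OF that] stage_iff[of pow c _ zero, OF fot_pow[OF fot_var] that] by metis
  then show ?thesis
    using mem_stage[of pow a x zero, OF fot_pow[OF fot_var] assms] assms ordinal_mem by (simp) metis
qed

lemma V_mem_V: "ordinal a \<Longrightarrow> b \<epsilon> a \<Longrightarrow> V b \<epsilon> V a"
  unfolding mem_V by (auto simp: sub_def)

lemma V_mono: "ordinal a \<Longrightarrow> b \<epsilon> a \<Longrightarrow> sub (V b) (V a)"
  unfolding sub_def using mem_V ordinal_mem ordinal_trans by meson

lemma V_downward: "ordinal a \<Longrightarrow> x \<epsilon> V a \<Longrightarrow> sub y x \<Longrightarrow> y \<epsilon> V a"
  unfolding mem_V sub_def by blast

lemma transitive_V: "ordinal a \<Longrightarrow> transitive (V a)"
  unfolding transitive_def using mem_V V_mono unfolding sub_def by meson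

text \<open>As \<open>V a\<close> is a definite description, it is only first-order definable for ordinals \<open>a\<close>.\<close>

definition Vo :: "'v \<Rightarrow> 'v" where
  "Vo a = (if ordinal a then V a else zero)"

lemma Vo_eq: "ordinal a \<Longrightarrow> Vo a = V a"
  by (simp add: Vo_def)

lemma fot_Vo [fo_intros]: "fot s \<Longrightarrow> fot (\<lambda>e. Vo (s e))"
proof (rule fot_subst1[of Vo])
  have "v = Vo a \<longleftrightarrow> (ordinal a \<and> (\<exists>h. approx pow zero h a \<and> v = ap h a)) \<or> (\<not> ordinal a \<and> v = zero)"
    for a v
    using V_iff[of a v] by (simp add: Vo_def)
  then show "fo (\<lambda>e. e 0 = Vo (e 1))"
    by (simp only:) (intro fo_intros fo_approx[of pow] fot_pow)
qed

section \<open>Ordinals and pairs inside the levels\<close>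

lemma ordinal_sub_V: assumes "ordinal a" shows "sub a (V a)"
proof -
  have "sub a (Vo a)" using assms
  proof (induction rule: ordinal_induct)
    case fo
    show ?case by (intro fo_intros)
  next
    case (step b)
    have "c \<epsilon> Vo b" if "c \<epsilon> b" for c
      using mem_V[OF step(1), of c] step(2)[OF that] that ordinal_mem[OF step(1) that] step(1)
      by (auto simp: Vo_eq)
    then show ?case by (simp add: sub_def)
  qed
  then show ?thesis using assms by (simp add: Vo_eq)
qed

text \<open>Ordinals are their own ranks: if \<open>b\<close> is included in V_c with c below
  \<open>a\<close>, then by induction all elements of \<open>b\<close> lie below c, so
  \<open>b\<close> is at most c.\<close>

lemma ordinal_mem_V_iff: assumes "ordinal a" "ordinal b" shows "b \<epsilon> V a \<longleftrightarrow> b \<epsilon> a"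
proof
  assume "b \<epsilon> a"
  then show "b \<epsilon> V a" using ordinal_sub_V[OF assms(1)] by (simp add: sub_def)
next
  have "\<forall>b. ordinal b \<longrightarrow> b \<epsilon> Vo a \<longrightarrow> b \<epsilon> a" using assms(1)
  proof (induction rule: ordinal_induct)
    case fo
    show ?case by (intro fo_intros)
  next
    case (step a)
    show ?case
    proof (intro allI impI)
      fix b assume b: "ordinal b" "b \<epsilon> Vo a"
      then obtain c where c: "c \<epsilon> a" "sub b (V c)"
        using mem_V[OF step(1)] step(1) by (auto simp: Vo_eq)
      have oc: "ordinal c" using c step(1) ordinal_mem by blast
      then have "sub b c" using c step(2)[OF c(1)] b(1) ordinal_mem[OF b(1)]
        by (auto simp: sub_def Vo_eq)
      then have "b \<epsilon> succ c" using ordinal_sub_iff b(1) oc by blast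
      then show "b \<epsilon> a" using c(1) ordinal_trans[OF step(1)] by auto
    qed
  qed
  then show "b \<epsilon> V a \<Longrightarrow> b \<epsilon> a" using assms by (simp add: Vo_eq)
qed

lemma V_limit_upair:
  assumes "ordinal a" and limit: "\<And>b. b \<epsilon> a \<Longrightarrow> succ b \<epsilon> a" and "x \<epsilon> V a" "y \<epsilon> V a"
  shows "upair x y \<epsilon> V a"
proof -
  obtain b c where bc: "b \<epsilon> a" "sub x (V b)" "c \<epsilon> a" "sub y (V c)"
    using assms mem_V by blast
  then have o: "ordinal b" "ordinal c" using assms(1) ordinal_mem by blast+
  have *: "\<exists>d. d \<epsilon> a \<and> sub x (V d) \<and> sub y (V d)"
    using ordinal_linear[OF o] V_mono[OF o(1), of c] V_mono[OF o(2), of b] bc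
    unfolding sub_def by blast
  then obtain d where d: "d \<epsilon> a" "sub x (V d)" "sub y (V d)" by blast
  then have "sub (upair x y) (V (succ d))"
    using mem_V[OF ordinal_succ[OF ordinal_mem[OF assms(1) d(1)]]] by (auto simp: sub_def)
  then show ?thesis using mem_V[OF assms(1)] limit[OF d(1)] by blast
qed

lemma V_omega_pair [simp]: "pair x y \<epsilon> V omega \<longleftrightarrow> x \<epsilon> V omega \<and> y \<epsilon> V omega"
proof
  assume "pair x y \<epsilon> V omega"
  then show "x \<epsilon> V omega \<and> y \<epsilon> V omega"
    using transitiveD[OF transitive_V[OF ordinal_omega]] unfolding pair_def by (metis mem_upair)
qed (auto simp: pair_def intro!: V_limit_upair)

lemma natural_mem_V_omega: "natural n \<Longrightarrow> n \<epsilon> V omega"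
  using ordinal_mem_V_iff[OF ordinal_omega] natural_ordinal by simp

section \<open>Codes of formulas\<close>

abbreviation num where "num \<equiv> Defs.num mem"
abbreviation mem_code where "mem_code \<equiv> Defs.mem_code mem"
abbreviation eq_code where "eq_code \<equiv> Defs.eq_code mem"
abbreviation neg_code where "neg_code \<equiv> Defs.neg_code mem"
abbreviation conj_code where "conj_code \<equiv> Defs.conj_code mem"
abbreviation all_code where "all_code \<equiv> Defs.all_code mem"
abbreviation formula_closed where "formula_closed \<equiv> Defs.formula_closed mem"
abbreviation formula where "formula \<equiv> Defs.formula mem"
abbreviation satisfaction_set where "satisfaction_set \<equiv> Defs.satisfaction_set mem"
abbreviation satisfies where "satisfies \<equiv> Defs.satisfies mem"

lemmas code_defs = mem_code_def eq_code_def neg_code_def conj_code_def all_code_def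

lemma natural_num: "natural (num k)"
  by (induction k) auto

lemma num_mem: "k < l \<Longrightarrow> num k \<epsilon> num l"
  by (induction l) (auto simp: less_Suc_eq)

lemma num_eq: "num k = num l \<longleftrightarrow> k = l"
  using num_mem[of k l] num_mem[of l k] by (cases k l rule: linorder_cases) auto

lemma code_eq [simp]:
  "mem_code i j = mem_code i' j' \<longleftrightarrow> i = i' \<and> j = j'"
  "eq_code i j = eq_code i' j' \<longleftrightarrow> i = i' \<and> j = j'"
  "neg_code f = neg_code f' \<longleftrightarrow> f = f'"
  "conj_code f g = conj_code f' g' \<longleftrightarrow> f = f' \<and> g = g'"
  "all_code f = all_code f' \<longleftrightarrow> f = f'"
  by (simp_all add: code_defs)

lemma code_neq [simp]:
  "mem_code i j \<noteq> eq_code k l" "mem_code i j \<noteq> neg_code f" "mem_code i j \<noteq> conj_code f g"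
  "mem_code i j \<noteq> all_code f" "eq_code i j \<noteq> mem_code k l" "eq_code i j \<noteq> neg_code f"
  "eq_code i j \<noteq> conj_code f g" "eq_code i j \<noteq> all_code f" "neg_code f \<noteq> mem_code i j"
  "neg_code f \<noteq> eq_code i j" "neg_code f \<noteq> conj_code g h" "neg_code f \<noteq> all_code g"
  "conj_code g h \<noteq> mem_code i j" "conj_code g h \<noteq> eq_code i j" "conj_code g h \<noteq> neg_code f"
  "conj_code g h \<noteq> all_code f" "all_code f \<noteq> mem_code i j" "all_code f \<noteq> eq_code i j"
  "all_code f \<noteq> neg_code g" "all_code f \<noteq> conj_code g h"
  unfolding code_defs pair_eq num_eq by simp_all

lemma fot_codes [fo_intros]:
  "fot s \<Longrightarrow> fot t \<Longrightarrow> fot (\<lambda>e. mem_code (s e) (t e))"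
  "fot s \<Longrightarrow> fot t \<Longrightarrow> fot (\<lambda>e. eq_code (s e) (t e))"
  "fot s \<Longrightarrow> fot (\<lambda>e. neg_code (s e))"
  "fot s \<Longrightarrow> fot t \<Longrightarrow> fot (\<lambda>e. conj_code (s e) (t e))"
  "fot s \<Longrightarrow> fot (\<lambda>e. all_code (s e))"
  unfolding code_defs by (intro fo_intros; assumption)+

lemma fo_formula_closed [fo_intros]: "fot s \<Longrightarrow> fo (\<lambda>e. formula_closed (s e))"
  by (rule fo_subst1[of formula_closed], unfold formula_closed_def) (intro fo_intros)

lemma fo_formula [fo_intros]: "fot s \<Longrightarrow> fot t \<Longrightarrow> fo (\<lambda>e. formula (s e) (t e))"
  by (rule fo_subst2[of formula], unfold formula_def) (intro fo_intros)

lemma formula_natural: "formula n f \<Longrightarrow> natural n"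
  unfolding formula_def by blast

lemma formula_atom:
  assumes "natural n" "i \<epsilon> n" "j \<epsilon> n"
  shows "formula n (mem_code i j)" "formula n (eq_code i j)"
  using assms unfolding formula_def formula_closed_def by blast+

lemma formula_neg: "formula n f \<Longrightarrow> formula n (neg_code f)"
  unfolding formula_def formula_closed_def by blast

lemma formula_conj: "formula n f \<Longrightarrow> formula n g \<Longrightarrow> formula n (conj_code f g)"
  unfolding formula_def formula_closed_def by blast

lemma formula_all: "natural n \<Longrightarrow> formula (succ n) f \<Longrightarrow> formula n (all_code f)"
  unfolding formula_def formula_closed_def by blast

text \<open>The definition of \<open>formula\<close> quantifies over all closed sets and would be
  vacuously true if there were none. This closed set also bounds all codes, which makes separation
  available for them.\<close>

lemma formula_closed_V_omega: "formula_closed (V omega)"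
  unfolding formula_closed_def code_defs
  by (simp add: natural_mem_V_omega natural_num) (metis natural_mem natural_mem_V_omega)

lemma formula_mem_V_omega: "formula n f \<Longrightarrow> f \<epsilon> V omega"
  using formula_closed_V_omega unfolding formula_def by (metis V_omega_pair)

text \<open>The pairs that satisfy both \<open>formula\<close> and \<open>P\<close> form a closed
  set, which therefore contains every formula.\<close>

lemma formula_induct [consumes 1, case_names fo mem eq neg conj all]:
  assumes "formula n f" and fo: "fo (\<lambda>e. P (e 0) (e 1))"
    and mem: "\<And>n i j. natural n \<Longrightarrow> i \<epsilon> n \<Longrightarrow> j \<epsilon> n \<Longrightarrow> P n (mem_code i j)"
    and eq: "\<And>n i j. natural n \<Longrightarrow> i \<epsilon> n \<Longrightarrow> j \<epsilon> n \<Longrightarrow> P n (eq_code i j)"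
    and neg: "\<And>n f. formula n f \<Longrightarrow> P n f \<Longrightarrow> P n (neg_code f)"
    and conj: "\<And>n f g. formula n f \<Longrightarrow> P n f \<Longrightarrow> formula n g \<Longrightarrow> P n g \<Longrightarrow> P n (conj_code f g)"
    and all: "\<And>n f. natural n \<Longrightarrow> formula (succ n) f \<Longrightarrow> P (succ n) f \<Longrightarrow> P n (all_code f)"
  shows "P n f"
proof -
  have foP: "fo (\<lambda>e. P (s e) (t e))" if "fot s" "fot t" for s t
    using fo_subst2[of P, OF fo that] .
  obtain X where X: "\<And>z. z \<epsilon> X \<longleftrightarrow> z \<epsilon> V omega \<and> (\<exists>n f. z = pair n f \<and> formula n f \<and> P n f)"
    by (rule separationE[of "\<lambda>z. \<exists>n f. z = pair n f \<and> formula n f \<and> P n f" "V omega"],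
        intro fo_intros foP, blast)
  have X': "pair n f \<epsilon> X \<longleftrightarrow> formula n f \<and> P n f" for n f
    using X formula_mem_V_omega formula_natural natural_mem_V_omega by auto
  have "formula_closed X" unfolding formula_closed_def X'
    by (simp add: formula_atom formula_neg formula_conj formula_all mem eq neg conj all)
  then show ?thesis using assms(1) X' unfolding formula_def by blast
qed

section \<open>Satisfaction\<close>

text \<open>The right-hand side of Tarski's recursion for an arbitrary set \<open>f\<close>; it is
  false when \<open>f\<close> has none of the five shapes. Not requiring \<open>f\<close> to be a
  formula permits a recursion on rank.\<close>

definition clause :: "'v \<Rightarrow> 'v \<Rightarrow> 'v \<Rightarrow> 'v \<Rightarrow> bool" where
  "clause M T f s \<longleftrightarrow> (\<exists>n. natural n \<and> fun_from_to s n M \<and>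
     ((\<exists>i j. i \<epsilon> n \<and> j \<epsilon> n \<and> f = mem_code i j \<and> ap s i \<epsilon> ap s j) \<or>
      (\<exists>i j. i \<epsilon> n \<and> j \<epsilon> n \<and> f = eq_code i j \<and> ap s i = ap s j) \<or>
      (\<exists>g. f = neg_code g \<and> \<not> pair g s \<epsilon> T) \<or>
      (\<exists>g h. f = conj_code g h \<and> pair g s \<epsilon> T \<and> pair h s \<epsilon> T) \<or>
      (\<exists>g. f = all_code g \<and> (\<forall>a. a \<epsilon> M \<longrightarrow> pair g (extend s n a) \<epsilon> T))))"

lemma clause_simps:
  assumes "natural n" "fun_from_to s n M"
  shows "i \<epsilon> n \<Longrightarrow> j \<epsilon> n \<Longrightarrow> clause M T (mem_code i j) s \<longleftrightarrow> app s i \<epsilon> app s j"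
    "i \<epsilon> n \<Longrightarrow> j \<epsilon> n \<Longrightarrow> clause M T (eq_code i j) s \<longleftrightarrow> app s i = app s j"
    "clause M T (neg_code g) s \<longleftrightarrow> \<not> pair g s \<epsilon> T"
    "clause M T (conj_code g h) s \<longleftrightarrow> pair g s \<epsilon> T \<and> pair h s \<epsilon> T"
    "clause M T (all_code g) s \<longleftrightarrow> (\<forall>a. a \<epsilon> M \<longrightarrow> pair g (extend s n a) \<epsilon> T)"
proof -
  \<comment> \<open>An assignment determines its domain, so the existential \<open>n\<close> inside
    \<open>clause\<close> can only be the given one.\<close>
  have n: "natural m \<and> fun_from_to s m M \<longleftrightarrow> m = n" for m
    using assms fun_dom_unique by blast
  show "i \<epsilon> n \<Longrightarrow> j \<epsilon> n \<Longrightarrow> clause M T (mem_code i j) s \<longleftrightarrow> app s i \<epsilon> app s j"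
    "i \<epsilon> n \<Longrightarrow> j \<epsilon> n \<Longrightarrow> clause M T (eq_code i j) s \<longleftrightarrow> app s i = app s j"
    "clause M T (neg_code g) s \<longleftrightarrow> \<not> pair g s \<epsilon> T"
    "clause M T (conj_code g h) s \<longleftrightarrow> pair g s \<epsilon> T \<and> pair h s \<epsilon> T"
    "clause M T (all_code g) s \<longleftrightarrow> (\<forall>a. a \<epsilon> M \<longrightarrow> pair g (extend s n a) \<epsilon> T)"
    unfolding clause_def conj_assoc[symmetric] n using ap_eq[OF assms(2)] by auto
qed

text \<open>A satisfaction set is glued together from sets that obey the clauses on the codes in \<open>V\<^sub>k\<close> only.\<close>

definition good :: "'v \<Rightarrow> 'v \<Rightarrow> 'v \<Rightarrow> bool" where
  "good M k T \<longleftrightarrow> (\<forall>f s. f \<epsilon> Vo k \<longrightarrow> (pair f s \<epsilon> T \<longleftrightarrow> clause M T f s))"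

lemma fo_clause [fo_intros]:
  assumes "fot s" "fot t" "fot u" "fot v" shows "fo (\<lambda>e. clause (s e) (t e) (u e) (v e))"
proof -
  have "fo (\<lambda>e. clause (e 0) (e 1) (e 2) (e 3))" unfolding clause_def by (intro fo_intros)
  then show ?thesis
    using fo_subst[of "\<lambda>e. clause (e 0) (e 1) (e 2) (e 3)"
        "\<lambda>i. if i = 0 then s else if i = 1 then t else if i = 2 then u else v"] assms by simp
qed

lemma fo_good [fo_intros]: "fot s \<Longrightarrow> fot t \<Longrightarrow> fot u \<Longrightarrow> fo (\<lambda>e. good (s e) (t e) (u e))"
  by (rule fo_subst3[of good], unfold good_def) (intro fo_intros)

lemma upair_mem_VD: "ordinal k \<Longrightarrow> upair x y \<epsilon> V k \<Longrightarrow> x \<epsilon> V k \<and> y \<epsilon> V k"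
  using transitiveD[OF transitive_V, of k "upair x y"] by simp

lemma pair_mem_VD: "ordinal k \<Longrightarrow> pair x y \<epsilon> V k \<Longrightarrow> x \<epsilon> V k \<and> y \<epsilon> V k"
  unfolding pair_def using upair_mem_VD by blast

text \<open>Codes keep their subcodes in the second component, so a subcode has smaller rank than
  the code. This drives the recursion on rank.\<close>

lemma pair_mem_V_succ:
  assumes "ordinal k" "pair x y \<epsilon> V (succ k)" shows "y \<epsilon> V k"
proof -
  obtain c where c: "c \<epsilon> succ k" "sub (pair x y) (V c)"
    using assms mem_V[OF ordinal_succ] by blast
  then have "upair x y \<epsilon> V c" by (simp add: sub_def pair_def)
  then have "y \<epsilon> V c"
    using c assms(1) upair_mem_VD ordinal_mem[OF ordinal_succ] by blast
  then show ?thesis using c(1) V_mono[OF assms(1)] by (auto simp: sub_def)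
qed

lemma clause_mono:
  assumes k: "ordinal k" "f \<epsilon> V (succ k)"
    and agree: "\<And>g s. g \<epsilon> V k \<Longrightarrow> pair g s \<epsilon> T \<longleftrightarrow> pair g s \<epsilon> T'"
    and "clause M T f s"
  shows "clause M T' f s"
proof -
  have sub: "f = neg_code g \<Longrightarrow> g \<epsilon> V k" "f = all_code g \<Longrightarrow> g \<epsilon> V k"
    "f = conj_code g h \<Longrightarrow> g \<epsilon> V k" "f = conj_code g h \<Longrightarrow> h \<epsilon> V k" for g h
    using k(2) pair_mem_V_succ[OF k(1)] pair_mem_VD[OF k(1)] unfolding code_defs by blast+
  from assms(4) obtain n where n: "natural n" "fun_from_to s n M" and
    "(\<exists>i j. i \<epsilon> n \<and> j \<epsilon> n \<and> f = mem_code i j \<and> ap s i \<epsilon> ap s j) \<or>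
      (\<exists>i j. i \<epsilon> n \<and> j \<epsilon> n \<and> f = eq_code i j \<and> ap s i = ap s j) \<or>
      (\<exists>g. f = neg_code g \<and> \<not> pair g s \<epsilon> T) \<or>
      (\<exists>g h. f = conj_code g h \<and> pair g s \<epsilon> T \<and> pair h s \<epsilon> T) \<or>
      (\<exists>g. f = all_code g \<and> (\<forall>a. a \<epsilon> M \<longrightarrow> pair g (extend s n a) \<epsilon> T))"
    unfolding clause_def by blast
  then show ?thesis
    using clause_simps[OF n, where T = T'] ap_eq[OF n(2)] agree sub
    by (elim disjE exE conjE) simp_all
qed

lemma clause_cong:
  assumes "ordinal k" "f \<epsilon> V (succ k)" "\<And>g s. g \<epsilon> V k \<Longrightarrow> pair g s \<epsilon> T \<longleftrightarrow> pair g s \<epsilon> T'"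
  shows "clause M T f s \<longleftrightarrow> clause M T' f s"
  using clause_mono[OF assms(1,2), of T T' M s] clause_mono[OF assms(1,2), of T' T M s] assms(3)
  by blast

section \<open>Existence of satisfaction sets\<close>

lemma seqs_ex: "\<exists>S. \<forall>s. s \<epsilon> S \<longleftrightarrow> (\<exists>n. natural n \<and> fun_from_to s n M)"
proof -
  obtain S where S: "\<And>s. s \<epsilon> S \<longleftrightarrow> s \<epsilon> pow (times omega M) \<and> (\<exists>n. natural n \<and> fun_from_to s n M)"
    by (rule separationE[of "\<lambda>s. \<exists>n. natural n \<and> fun_from_to s n M" "pow (times omega M)"],
        intro fo_intros, blast)
  have "s \<epsilon> pow (times omega M)" if "natural n" "fun_from_to s n M" for s n
    using that natural_mem unfolding mem_pow sub_def mem_times fun_from_to_def mem_omega by blast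
  then show ?thesis using S by blast
qed

lemma clause_seq: "clause M T f s \<Longrightarrow> \<exists>n. natural n \<and> fun_from_to s n M"
  unfolding clause_def by blast

lemma good_mono: "ordinal k \<Longrightarrow> j \<epsilon> k \<Longrightarrow> good M k T \<Longrightarrow> good M j T"
  unfolding good_def using V_mono[of k j] ordinal_mem[of k j] by (auto simp: sub_def Vo_eq)

text \<open>By induction on \<open>k\<close>: the clause for a code in V_(k+1) only looks at
  subcodes in V_k, where agreement under all assignments is already known.\<close>

lemma good_unique:
  assumes "natural k" "good M k T" "good M k T'" "f \<epsilon> V k"
  shows "pair f s \<epsilon> T \<longleftrightarrow> pair f s \<epsilon> T'"
proof -
  have "\<forall>T T' f s. good M k T \<and> good M k T' \<and> f \<epsilon> Vo k \<longrightarrow> (pair f s \<epsilon> T \<longleftrightarrow> pair f s \<epsilon> T')"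
    using assms(1)
  proof (induction rule: natural_induct)
    case fo
    show ?case by (intro fo_intros)
  next
    case zero
    then show ?case by (simp add: Vo_eq mem_V)
  next
    case (succ k)
    have o: "ordinal k" "ordinal (succ k)" using succ(1) natural_ordinal ordinal_succ by blast+
    show ?case
    proof (intro allI impI, elim conjE)
      fix T T' f s assume T: "good M (succ k) T" "good M (succ k) T'" and "f \<epsilon> Vo (succ k)"
      then have f: "f \<epsilon> V (succ k)" using o by (simp add: Vo_eq)
      have "good M k T" "good M k T'" using T good_mono[OF o(2)] by auto
      then have "pair g s \<epsilon> T \<longleftrightarrow> pair g s \<epsilon> T'" if "g \<epsilon> V k" for g s
        using that succ(2) unfolding Vo_eq[OF o(1)] by blast
      then have "clause M T f s \<longleftrightarrow> clause M T' f s" using clause_cong[OF o(1) f] by blast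
      then show "pair f s \<epsilon> T \<longleftrightarrow> pair f s \<epsilon> T'" using T f o unfolding good_def by (simp add: Vo_eq)
    qed
  qed
  then show ?thesis
    using assms(2-4) unfolding Vo_eq[OF natural_ordinal[OF assms(1)]] by blast
qed

lemma good_ex: "natural k \<Longrightarrow> \<exists>T. good M k T"
proof (induction rule: natural_induct)
  case fo
  show ?case by (intro fo_intros)
next
  case zero
  then show ?case by (simp add: good_def Vo_eq mem_V)
next
  case (succ k)
  then obtain T where T: "good M k T" by blast
  have o: "ordinal k" "ordinal (succ k)" using succ(1) natural_ordinal ordinal_succ by blast+
  obtain S where S: "\<And>s. s \<epsilon> S \<longleftrightarrow> (\<exists>n. natural n \<and> fun_from_to s n M)" using seqs_ex by blast
  obtain T' where "\<And>z. z \<epsilon> T' \<longleftrightarrow> z \<epsilon> times (V (succ k)) S \<and> (\<exists>f s. z = pair f s \<and> clause M T f s)"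
    by (rule separationE[of "\<lambda>z. \<exists>f s. z = pair f s \<and> clause M T f s" "times (V (succ k)) S"],
        intro fo_intros, blast)
  then have T': "pair f s \<epsilon> T' \<longleftrightarrow> f \<epsilon> V (succ k) \<and> clause M T f s" for f s
    using clause_seq S by auto
  \<comment> \<open>The new set repeats the verdicts of \<open>T\<close> on V_k, so the clauses on
    V_(k+1) may be read in \<open>T'\<close> instead of \<open>T\<close>.\<close>
  have "pair f s \<epsilon> T' \<longleftrightarrow> pair f s \<epsilon> T" if "f \<epsilon> V k" for f s
    using T' T that V_mono[OF o(2), of k] o unfolding good_def by (auto simp: sub_def Vo_eq)
  then have "good M (succ k) T'"
    unfolding good_def using T' clause_cong[OF o(1), of _ T' T M] o by (simp add: Vo_eq)
  then show ?case by blast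
qed

text \<open>Collects the verdicts of all locally good sets. Uniqueness makes them compatible, and
  every code in V_omega already lies in V_k for some natural number k.\<close>

lemma satisfaction_set_ex: "\<exists>T. satisfaction_set M T"
proof -
  obtain S where S: "\<And>s. s \<epsilon> S \<longleftrightarrow> (\<exists>n. natural n \<and> fun_from_to s n M)" using seqs_ex by blast
  obtain T where T0: "\<And>z. z \<epsilon> T \<longleftrightarrow> z \<epsilon> times (V omega) S \<and>
      (\<exists>f s k T. z = pair f s \<and> natural k \<and> good M k T \<and> f \<epsilon> Vo k \<and> pair f s \<epsilon> T)"
    by (rule separationE[of "\<lambda>z. \<exists>f s k T. z = pair f s \<and> natural k \<and> good M k T \<and> f \<epsilon> Vo k \<and>
          pair f s \<epsilon> T" "times (V omega) S"], intro fo_intros, blast)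
  have T: "pair f s \<epsilon> T \<longleftrightarrow> pair f s \<epsilon> T'" if k: "natural k" "good M k T'" "f \<epsilon> V k" for f s k T'
  proof
    assume "pair f s \<epsilon> T'"
    moreover from this have "clause M T' f s"
      using k natural_ordinal unfolding good_def by (simp add: Vo_eq)
    moreover have "f \<epsilon> V omega"
      using k V_mono[OF ordinal_omega, of k] by (auto simp: sub_def)
    ultimately show "pair f s \<epsilon> T"
      unfolding T0 using k clause_seq S natural_ordinal Vo_eq pair_mem_times by metis
  next
    assume "pair f s \<epsilon> T"
    then obtain j U where j: "natural j" "good M j U" "f \<epsilon> V j" "pair f s \<epsilon> U"
      unfolding T0 using Vo_eq natural_ordinal by auto
    have o: "ordinal j" "ordinal k" using j k natural_ordinal by blast+
    \<comment> \<open>Of the two levels one is at most the other, and goodness passes to the smaller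
      level; both sets are then compared there.\<close>
    have "(good M j T' \<or> good M k U)"
      using ordinal_linear[OF o] good_mono[OF o(1)] good_mono[OF o(2)] j(2) k(2) by blast
    then show "pair f s \<epsilon> T'" using good_unique j k by blast
  qed
  have T_clause: "pair f s \<epsilon> T \<longleftrightarrow> clause M T f s" if f: "f \<epsilon> V omega" for f s
  proof -
    obtain k where k: "natural k" "sub f (V k)" using f mem_V[OF ordinal_omega] by auto
    have o: "ordinal k" "ordinal (succ k)" using k(1) natural_ordinal ordinal_succ by blast+
    have fk: "f \<epsilon> V (succ k)" using mem_V[OF o(2)] k by auto
    obtain U where U: "good M (succ k) U" using good_ex[of "succ k" M] k by auto
    then have "good M k U" using good_mono[OF o(2)] by auto
    then have "clause M T f s \<longleftrightarrow> clause M U f s" using clause_cong[OF o(1) fk] T[OF k(1)] by blast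
    moreover have "pair f s \<epsilon> T \<longleftrightarrow> pair f s \<epsilon> U" using T[OF _ U fk] k(1) by simp
    ultimately show ?thesis using U fk o unfolding good_def by (simp add: Vo_eq)
  qed
  have "satisfaction_set M T" unfolding satisfaction_set_def
  proof (intro allI impI)
    fix n s assume "natural n \<and> fun_from_to s n M"
    then have ns: "natural n" "fun_from_to s n M" by auto
    note V = formula_mem_V_omega and C = clause_simps[OF ns, where T = T]
    show "(\<forall>i j. i \<epsilon> n \<and> j \<epsilon> n \<longrightarrow> (pair (mem_code i j) s \<epsilon> T \<longleftrightarrow> app s i \<epsilon> app s j)) \<and>
     (\<forall>i j. i \<epsilon> n \<and> j \<epsilon> n \<longrightarrow> (pair (eq_code i j) s \<epsilon> T \<longleftrightarrow> app s i = app s j)) \<and>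
     (\<forall>f. formula n f \<longrightarrow> (pair (neg_code f) s \<epsilon> T \<longleftrightarrow> \<not> pair f s \<epsilon> T)) \<and>
     (\<forall>f g. formula n f \<and> formula n g \<longrightarrow>
        (pair (conj_code f g) s \<epsilon> T \<longleftrightarrow> pair f s \<epsilon> T \<and> pair g s \<epsilon> T)) \<and>
     (\<forall>f. formula (succ n) f \<longrightarrow>
        (pair (all_code f) s \<epsilon> T \<longleftrightarrow> (\<forall>a. a \<epsilon> M \<longrightarrow> pair f (extend s n a) \<epsilon> T)))"
    proof (intro conjI allI impI)
      fix i j assume "i \<epsilon> n \<and> j \<epsilon> n"
      then have ij: "i \<epsilon> n" "j \<epsilon> n" by auto
      show "pair (mem_code i j) s \<epsilon> T \<longleftrightarrow> app s i \<epsilon> app s j"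
        using T_clause[OF V[OF formula_atom(1)[OF ns(1) ij]]] C(1)[OF ij] by blast
      show "pair (eq_code i j) s \<epsilon> T \<longleftrightarrow> app s i = app s j"
        using T_clause[OF V[OF formula_atom(2)[OF ns(1) ij]]] C(2)[OF ij] by blast
    next
      fix f assume "formula n f"
      then show "pair (neg_code f) s \<epsilon> T \<longleftrightarrow> \<not> pair f s \<epsilon> T"
        using T_clause[OF V[OF formula_neg]] C(3) by blast
    next
      fix f g assume "formula n f \<and> formula n g"
      then show "pair (conj_code f g) s \<epsilon> T \<longleftrightarrow> pair f s \<epsilon> T \<and> pair g s \<epsilon> T"
        using T_clause[OF V[OF formula_conj]] C(4) by blast
    next
      fix f assume "formula (succ n) f"
      then show "pair (all_code f) s \<epsilon> T \<longleftrightarrow> (\<forall>a. a \<epsilon> M \<longrightarrow> pair f (extend s n a) \<epsilon> T)"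
        using T_clause[OF V[OF formula_all[OF ns(1)]]] C(5) by blast
    qed
  qed
  then show ?thesis by blast
qed

section \<open>Tarski's clauses for satisfaction\<close>

lemma satisfaction_setD:
  assumes "satisfaction_set M T" "natural n" "fun_from_to s n M"
  shows "i \<epsilon> n \<Longrightarrow> j \<epsilon> n \<Longrightarrow> pair (mem_code i j) s \<epsilon> T \<longleftrightarrow> app s i \<epsilon> app s j"
    "i \<epsilon> n \<Longrightarrow> j \<epsilon> n \<Longrightarrow> pair (eq_code i j) s \<epsilon> T \<longleftrightarrow> app s i = app s j"
    "formula n f \<Longrightarrow> pair (neg_code f) s \<epsilon> T \<longleftrightarrow> \<not> pair f s \<epsilon> T"
    "formula n f \<Longrightarrow> formula n g \<Longrightarrow> pair (conj_code f g) s \<epsilon> T \<longleftrightarrow> pair f s \<epsilon> T \<and> pair g s \<epsilon> T"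
    "formula (succ n) f \<Longrightarrow>
       pair (all_code f) s \<epsilon> T \<longleftrightarrow> (\<forall>a. a \<epsilon> M \<longrightarrow> pair f (extend s n a) \<epsilon> T)"
proof -
  note A = assms(1)[unfolded satisfaction_set_def, THEN spec[of _ n], THEN spec[of _ s], THEN mp,
      OF conjI[OF assms(2,3)]]
  note A1 = A[THEN conjunct2] note A2 = A1[THEN conjunct2] note A3 = A2[THEN conjunct2]
  show "i \<epsilon> n \<Longrightarrow> j \<epsilon> n \<Longrightarrow> pair (mem_code i j) s \<epsilon> T \<longleftrightarrow> app s i \<epsilon> app s j"
    using A[THEN conjunct1] by simp
  show "i \<epsilon> n \<Longrightarrow> j \<epsilon> n \<Longrightarrow> pair (eq_code i j) s \<epsilon> T \<longleftrightarrow> app s i = app s j"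
    using A1[THEN conjunct1] by simp
  show "formula n f \<Longrightarrow> pair (neg_code f) s \<epsilon> T \<longleftrightarrow> \<not> pair f s \<epsilon> T"
    using A2[THEN conjunct1] by simp
  show "formula n f \<Longrightarrow> formula n g \<Longrightarrow> pair (conj_code f g) s \<epsilon> T \<longleftrightarrow> pair f s \<epsilon> T \<and> pair g s \<epsilon> T"
    using A3[THEN conjunct1] by simp
  show "formula (succ n) f \<Longrightarrow>
       pair (all_code f) s \<epsilon> T \<longleftrightarrow> (\<forall>a. a \<epsilon> M \<longrightarrow> pair f (extend s n a) \<epsilon> T)"
    using A3[THEN conjunct2] by simp
qed

text \<open>Outside formulas and matching assignments, satisfaction sets are unconstrained. On the
  relevant pairs they agree, which makes the existential definition of \<open>satisfies\<close>
  independent of the chosen set.\<close>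

lemma satisfaction_set_unique:
  assumes "formula n f" and T: "satisfaction_set M T" "satisfaction_set M T'"
    and "fun_from_to s n M"
  shows "pair f s \<epsilon> T \<longleftrightarrow> pair f s \<epsilon> T'"
proof -
  have "\<forall>s. fun_from_to s n M \<longrightarrow> (pair f s \<epsilon> T \<longleftrightarrow> pair f s \<epsilon> T')"
    using assms(1)
  proof (induction rule: formula_induct)
    case fo
    show ?case by (intro fo_intros)
  next
    case (neg n f)
    then show ?case
      using T[THEN satisfaction_setD(3), OF formula_natural[OF neg(1)] _ neg(1)] by simp
  next
    case (conj n f g)
    then show ?case
      using T[THEN satisfaction_setD(4), OF formula_natural[OF conj(1)] _ conj.hyps] by simp
  next
    case (all n f)
    then show ?case
      using T[THEN satisfaction_setD(5), OF all(1) _ all(2)] fun_extend by simp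
  next
    case (mem n i j)
    then show ?case using T[THEN satisfaction_setD(1), OF mem(1) _ mem(2,3)] by simp
  next
    case (eq n i j)
    then show ?case using T[THEN satisfaction_setD(2), OF eq(1) _ eq(2,3)] by simp
  qed
  then show ?thesis using assms(4) by blast
qed

lemma satisfies_iff:
  assumes "satisfaction_set M T" "formula n f" "fun_from_to s n M"
  shows "satisfies M f s \<longleftrightarrow> pair f s \<epsilon> T"
  unfolding satisfies_def using satisfaction_set_unique[OF assms(2) _ assms(1) assms(3)] assms(1)
  by blast

lemma satisfies_simps:
  assumes "natural n" "fun_from_to s n M"
  shows "i \<epsilon> n \<Longrightarrow> j \<epsilon> n \<Longrightarrow> satisfies M (mem_code i j) s \<longleftrightarrow> app s i \<epsilon> app s j"
    "i \<epsilon> n \<Longrightarrow> j \<epsilon> n \<Longrightarrow> satisfies M (eq_code i j) s \<longleftrightarrow> app s i = app s j"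
    "formula n f \<Longrightarrow> satisfies M (neg_code f) s \<longleftrightarrow> \<not> satisfies M f s"
    "formula n f \<Longrightarrow> formula n g \<Longrightarrow>
       satisfies M (conj_code f g) s \<longleftrightarrow> satisfies M f s \<and> satisfies M g s"
    "formula (succ n) f \<Longrightarrow>
       satisfies M (all_code f) s \<longleftrightarrow> (\<forall>a. a \<epsilon> M \<longrightarrow> satisfies M f (extend s n a))"
proof -
  obtain T where T: "satisfaction_set M T" using satisfaction_set_ex by blast
  note D = satisfaction_setD[OF T assms] and I = satisfies_iff[OF T _ assms(2)]
  show "satisfies M (mem_code i j) s \<longleftrightarrow> app s i \<epsilon> app s j" if "i \<epsilon> n" "j \<epsilon> n"
    using D(1) I[OF formula_atom(1)] that assms(1) by simp
  show "satisfies M (eq_code i j) s \<longleftrightarrow> app s i = app s j" if "i \<epsilon> n" "j \<epsilon> n"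
    using D(2) I[OF formula_atom(2)] that assms(1) by simp
  show "satisfies M (neg_code f) s \<longleftrightarrow> \<not> satisfies M f s" if "formula n f"
    using D(3) I[OF formula_neg] I that by simp
  show "satisfies M (conj_code f g) s \<longleftrightarrow> satisfies M f s \<and> satisfies M g s"
    if "formula n f" "formula n g"
    using D(4) I[OF formula_conj] I that by simp
  show "satisfies M (all_code f) s \<longleftrightarrow> (\<forall>a. a \<epsilon> M \<longrightarrow> satisfies M f (extend s n a))"
    if "formula (succ n) f"
    using D(5) I[OF formula_all] satisfies_iff[OF T that fun_extend[OF assms(2)]] that assms(1)
    by simp
qed

lemma fo_satisfaction_set [fo_intros]:
  "fot s \<Longrightarrow> fot t \<Longrightarrow> fo (\<lambda>e. satisfaction_set (s e) (t e))"
proof (rule fo_subst2[of satisfaction_set])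
  have "satisfaction_set M T \<longleftrightarrow> (\<forall>n s. natural n \<and> fun_from_to s n M \<longrightarrow>
     (\<forall>i j. i \<epsilon> n \<and> j \<epsilon> n \<longrightarrow> (pair (mem_code i j) s \<epsilon> T \<longleftrightarrow> ap s i \<epsilon> ap s j)) \<and>
     (\<forall>i j. i \<epsilon> n \<and> j \<epsilon> n \<longrightarrow> (pair (eq_code i j) s \<epsilon> T \<longleftrightarrow> ap s i = ap s j)) \<and>
     (\<forall>f. formula n f \<longrightarrow> (pair (neg_code f) s \<epsilon> T \<longleftrightarrow> \<not> pair f s \<epsilon> T)) \<and>
     (\<forall>f g. formula n f \<and> formula n g \<longrightarrow>
        (pair (conj_code f g) s \<epsilon> T \<longleftrightarrow> pair f s \<epsilon> T \<and> pair g s \<epsilon> T)) \<and>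
     (\<forall>f. formula (succ n) f \<longrightarrow>
        (pair (all_code f) s \<epsilon> T \<longleftrightarrow> (\<forall>a. a \<epsilon> M \<longrightarrow> pair f (extend s n a) \<epsilon> T))))" for M T
    unfolding satisfaction_set_def
    by (intro all_cong1 imp_cong conj_cong refl; elim conjE; simp add: ap_eq)
  then show "fo (\<lambda>e. satisfaction_set (e 0) (e 1))" by (simp only:) (intro fo_intros)
qed

lemma fo_satisfies [fo_intros]:
  "fot s \<Longrightarrow> fot t \<Longrightarrow> fot u \<Longrightarrow> fo (\<lambda>e. satisfies (s e) (t e) (u e))"
  by (rule fo_subst3[of satisfies], unfold satisfies_def) (intro fo_intros)

section \<open>Defining the levels of the cumulative hierarchy without functions\<close>

text \<open>
  The sets \<open>{V\<^sub>\<beta> | \<beta> \<le> \<alpha>}\<close> are histories, and \<open>V\<^sub>\<alpha>\<close> is the only member \<open>v\<close> of a history with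
  \<open>\<alpha> \<subseteq> v\<close> and \<open>\<alpha> \<notin> v\<close>. Being a history is absolute for \<open>V\<^sub>\<theta>\<close>, since \<open>V\<^sub>\<theta>\<close> is transitive and
  closed under subsets.
\<close>

definition history :: "'v \<Rightarrow> bool" where
  "history h \<longleftrightarrow> (\<forall>u. u \<epsilon> h \<longrightarrow> (\<forall>x. x \<epsilon> u \<longleftrightarrow> (\<exists>y. y \<epsilon> h \<and> y \<epsilon> u \<and> sub x y)))"

text \<open>All V_b with b at most \<open>a\<close> lie in V_(a+1), so the set of them lies two
  levels above \<open>a\<close>. This accounts for the hypothesis \<open>succ a \<epsilon> t\<close>
  when formulas are lifted to V_t.\<close>

lemma history_ex:
  assumes "ordinal a" shows "\<exists>h. h \<epsilon> V (succ (succ a)) \<and> history h \<and> V a \<epsilon> h"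
proof -
  have o: "ordinal (succ a)" "ordinal (succ (succ a))" using assms ordinal_succ by blast+
  obtain h where "\<And>y. y \<epsilon> h \<longleftrightarrow> (\<exists>b. b \<epsilon> succ a \<and> y = Vo b)"
    using replacement_fot[of Vo "succ a"] fot_Vo[OF fot_var] by blast
  then have h: "y \<epsilon> h \<longleftrightarrow> (\<exists>b. b \<epsilon> succ a \<and> y = V b)" for y
    using Vo_eq ordinal_mem[OF o(1)] by metis
  have "history h" unfolding history_def
  proof (intro allI impI)
    fix u x assume "u \<epsilon> h"
    then obtain b where b: "b \<epsilon> succ a" "u = V b" using h by blast
    then have ob: "ordinal b" using o ordinal_mem by blast
    show "x \<epsilon> u \<longleftrightarrow> (\<exists>y. y \<epsilon> h \<and> y \<epsilon> u \<and> sub x y)"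
    proof
      assume "x \<epsilon> u"
      then obtain c where c: "c \<epsilon> b" "sub x (V c)" using mem_V[OF ob] b(2) by blast
      moreover have "V c \<epsilon> h" using h ordinal_trans[OF o(1) b(1) c(1)] by blast
      ultimately show "\<exists>y. y \<epsilon> h \<and> y \<epsilon> u \<and> sub x y" using V_mem_V[OF ob c(1)] b(2) by blast
    next
      assume "\<exists>y. y \<epsilon> h \<and> y \<epsilon> u \<and> sub x y"
      then show "x \<epsilon> u" using V_downward[OF ob] b(2) by blast
    qed
  qed
  moreover have "sub h (V (succ a))" by (auto simp: sub_def h V_mem_V[OF o(1)] simp del: mem_succ)
  then have "h \<epsilon> V (succ (succ a))" using mem_V[OF o(2)] by auto
  moreover have "V a \<epsilon> h" unfolding h by (rule exI[of _ a]) simp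
  ultimately show ?thesis by blast
qed

text \<open>An \<in>-minimal member \<open>u\<close> of \<open>h\<close> that is not a level has
  only levels among its own members from \<open>h\<close>; the defining condition of a history then
  makes \<open>u\<close> a level after all.\<close>

lemma history_memD:
  assumes "history h" "u \<epsilon> h" shows "\<exists>b. ordinal b \<and> u = V b"
proof (rule ccontr)
  assume *: "\<not> (\<exists>b. ordinal b \<and> u = V b)"
  obtain w where "\<And>u. u \<epsilon> w \<longleftrightarrow> u \<epsilon> h \<and> \<not> (\<exists>b. ordinal b \<and> u = Vo b)"
    by (rule separationE[of "\<lambda>u. \<not> (\<exists>b. ordinal b \<and> u = Vo b)" h], intro fo_intros, blast)
  then have w: "u \<epsilon> w \<longleftrightarrow> u \<epsilon> h \<and> \<not> (\<exists>b. ordinal b \<and> u = V b)" for u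
    using Vo_eq by metis
  have "\<exists>u. u \<epsilon> w" using assms * w by blast
  then obtain u where u: "u \<epsilon> w" "\<And>z. z \<epsilon> w \<Longrightarrow> \<not> z \<epsilon> u" using foundation[of w] by blast
  have uh: "u \<epsilon> h" using u(1) w by blast
  have h: "x \<epsilon> u \<longleftrightarrow> (\<exists>y. y \<epsilon> h \<and> y \<epsilon> u \<and> sub x y)" for x
    using assms(1) uh unfolding history_def by blast
  have V: "\<exists>c. ordinal c \<and> y = V c" if "y \<epsilon> h" "y \<epsilon> u" for y using that u w by blast
  \<comment> \<open>The index is recovered from \<open>u\<close> as the set of its ordinals, since
    the ordinals in V_b are the elements of b.\<close>
  obtain b where b: "\<And>c. c \<epsilon> b \<longleftrightarrow> c \<epsilon> u \<and> ordinal c"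
    by (rule separationE[of ordinal u], intro fo_intros, blast)
  have u_V: "x \<epsilon> u \<longleftrightarrow> (\<exists>c. ordinal c \<and> V c \<epsilon> h \<and> V c \<epsilon> u \<and> sub x (V c))" for x
    using h V by blast
  have "transitive b" unfolding transitive_def sub_def
  proof (intro allI impI)
    fix c d assume c: "c \<epsilon> b" "d \<epsilon> c"
    then have d: "ordinal d" using b ordinal_mem by blast
    obtain e where e: "ordinal e" "V e \<epsilon> h" "V e \<epsilon> u" "sub c (V e)" using c b u_V by blast
    have "sub d (V e)" using transitive_V[OF e(1)] e(4) c(2) unfolding transitive_def sub_def by blast
    then show "d \<epsilon> b" using u_V e b d by blast
  qed
  then have ob: "ordinal b" using ordinalI b by blast
  have "x \<epsilon> u \<longleftrightarrow> x \<epsilon> V b" for x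
  proof
    assume "x \<epsilon> u"
    then obtain c where c: "ordinal c" "V c \<epsilon> h" "V c \<epsilon> u" "sub x (V c)" using u_V by blast
    then have "c \<epsilon> b" using b u_V ordinal_sub_V by blast
    then show "x \<epsilon> V b" using mem_V[OF ob] c by blast
  next
    assume "x \<epsilon> V b"
    then obtain c where c: "c \<epsilon> b" "sub x (V c)" using mem_V[OF ob] by blast
    \<comment> \<open>That V_c itself belongs to \<open>h\<close> is not known. The history does
      provide some V_d in \<open>u\<close> that includes \<open>c\<close>, and c being at most d is
      enough.\<close>
    then obtain d where d: "ordinal d" "V d \<epsilon> h" "V d \<epsilon> u" "sub c (V d)" using b u_V by blast
    have oc: "ordinal c" using c b by blast
    have "sub c d" unfolding sub_def
      using d(4) ordinal_mem_V_iff[OF d(1)] ordinal_mem[OF oc] unfolding sub_def by blast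
    then have "c \<epsilon> succ d" using ordinal_sub_iff[OF oc d(1)] by blast
    then have "sub (V c) (V d)" using V_mono[OF d(1)] by (auto simp: sub_def)
    then have "sub x (V d)" using c(2) unfolding sub_def by blast
    then show "x \<epsilon> u" using u_V d by blast
  qed
  then have "u = V b" by (rule set_eqI)
  then show False using u(1) w ob by blast
qed

lemma history_eq_V:
  assumes "ordinal a" "history h" "v \<epsilon> h" "sub a v" "\<not> a \<epsilon> v" shows "v = V a"
proof -
  obtain b where b: "ordinal b" "v = V b" using history_memD assms by blast
  have "sub a b"
    using assms(4) ordinal_mem_V_iff[OF b(1)] ordinal_mem[OF assms(1)] b(2)
    unfolding sub_def by blast
  moreover have "\<not> a \<epsilon> b" using assms(5) ordinal_mem_V_iff[OF b(1) assms(1)] b(2) by blast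
  ultimately have "a = b" using ordinal_subset_mem assms(1) b(1) by blast
  then show ?thesis using b by simp
qed

section \<open>Expressible properties of assignments\<close>

text \<open>A semantic interface to the codes: explicit formulas are built by closure properties of
  \<open>P\<close>, and only its values at assignments into \<open>M\<close> of length
  \<open>n\<close> matter.\<close>

definition expressible :: "'v \<Rightarrow> 'v \<Rightarrow> ('v \<Rightarrow> bool) \<Rightarrow> bool" where
  "expressible M n P \<longleftrightarrow>
     (\<exists>f. formula n f \<and> (\<forall>s. fun_from_to s n M \<longrightarrow> (satisfies M f s \<longleftrightarrow> P s)))"

lemma expressible_cong:
  "expressible M n P \<Longrightarrow> (\<And>s. fun_from_to s n M \<Longrightarrow> P s \<longleftrightarrow> Q s) \<Longrightarrow> expressible M n Q"
  unfolding expressible_def by metis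

lemma expressible_satisfies: "formula n f \<Longrightarrow> expressible M n (\<lambda>s. satisfies M f s)"
  unfolding expressible_def by blast

lemma expressible_mem:
  "natural n \<Longrightarrow> i \<epsilon> n \<Longrightarrow> j \<epsilon> n \<Longrightarrow> expressible M n (\<lambda>s. app s i \<epsilon> app s j)"
  unfolding expressible_def using formula_atom(1) satisfies_simps(1) by blast

lemma expressible_not: assumes "expressible M n P" shows "expressible M n (\<lambda>s. \<not> P s)"
proof -
  obtain f where f: "formula n f" "\<And>s. fun_from_to s n M \<Longrightarrow> satisfies M f s \<longleftrightarrow> P s"
    using assms unfolding expressible_def by blast
  then show ?thesis unfolding expressible_def
    using satisfies_simps(3)[OF formula_natural[OF f(1)] _ f(1)] formula_neg[OF f(1)] by blast
qed

lemma expressible_conj: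
  assumes "expressible M n P" "expressible M n Q" shows "expressible M n (\<lambda>s. P s \<and> Q s)"
proof -
  obtain f where f: "formula n f" "\<And>s. fun_from_to s n M \<Longrightarrow> satisfies M f s \<longleftrightarrow> P s"
    using assms unfolding expressible_def by blast
  obtain g where g: "formula n g" "\<And>s. fun_from_to s n M \<Longrightarrow> satisfies M g s \<longleftrightarrow> Q s"
    using assms unfolding expressible_def by blast
  show ?thesis unfolding expressible_def
    using satisfies_simps(4)[OF formula_natural[OF f(1)] _ f(1) g(1)] formula_conj[OF f(1) g(1)] f g
    by blast
qed

text \<open>With de Bruijn levels the bound value is entry \<open>n\<close> of the extended
  assignment. \<open>Q\<close> is the body that reads it from there; unification cannot find it, so
  it is given explicitly in most uses.\<close>

lemma expressible_all:
  assumes "natural n" "expressible M (succ n) Q"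
    and "\<And>s a. fun_from_to s n M \<Longrightarrow> a \<epsilon> M \<Longrightarrow> Q (extend s n a) \<longleftrightarrow> P s a"
  shows "expressible M n (\<lambda>s. \<forall>a. a \<epsilon> M \<longrightarrow> P s a)"
proof -
  obtain f where f: "formula (succ n) f" "\<And>s. fun_from_to s (succ n) M \<Longrightarrow> satisfies M f s \<longleftrightarrow> Q s"
    using assms unfolding expressible_def by blast
  have "satisfies M (all_code f) s \<longleftrightarrow> (\<forall>a. a \<epsilon> M \<longrightarrow> P s a)" if "fun_from_to s n M" for s
    using satisfies_simps(5)[OF assms(1) that f(1)] f(2)[OF fun_extend[OF that]] assms(3)[OF that]
    by simp
  then show ?thesis unfolding expressible_def using formula_all[OF assms(1) f(1)] by blast
qed

lemma expressible_imp:
  "expressible M n P \<Longrightarrow> expressible M n Q \<Longrightarrow> expressible M n (\<lambda>s. P s \<longrightarrow> Q s)"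
  using expressible_not[OF expressible_conj[OF _ expressible_not], of M n P Q] by simp

lemma expressible_iff:
  "expressible M n P \<Longrightarrow> expressible M n Q \<Longrightarrow> expressible M n (\<lambda>s. P s \<longleftrightarrow> Q s)"
  using expressible_conj[OF expressible_imp expressible_imp, of M n P Q Q P]
  by (simp add: iff_conv_conj_imp)

lemma expressible_ex:
  assumes "natural n" "expressible M (succ n) Q"
    and "\<And>s a. fun_from_to s n M \<Longrightarrow> a \<epsilon> M \<Longrightarrow> Q (extend s n a) \<longleftrightarrow> P s a"
  shows "expressible M n (\<lambda>s. \<exists>a. a \<epsilon> M \<and> P s a)"
  using expressible_not[OF expressible_all[OF assms(1) expressible_not[OF assms(2)],
        of "\<lambda>s a. \<not> P s a"]] assms(3) by simp

lemma expressible_sub: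
  assumes "transitive M" "natural n" "i \<epsilon> n" "j \<epsilon> n"
  shows "expressible M n (\<lambda>s. sub (app s i) (app s j))"
proof (rule expressible_cong)
  show "expressible M n (\<lambda>s. \<forall>a. a \<epsilon> M \<longrightarrow> (a \<epsilon> app s i \<longrightarrow> a \<epsilon> app s j))"
    by (rule expressible_all[where Q = "\<lambda>s. app s n \<epsilon> app s i \<longrightarrow> app s n \<epsilon> app s j"])
      (auto simp: assms app_extend[of _ _ M] intro!: expressible_imp expressible_mem)
  show "(\<forall>a. a \<epsilon> M \<longrightarrow> (a \<epsilon> app s i \<longrightarrow> a \<epsilon> app s j)) \<longleftrightarrow> sub (app s i) (app s j)"
    if "fun_from_to s n M" for s
    using transitiveD[OF assms(1) fun_app(2)[OF that assms(3)]] unfolding sub_def by blast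
qed

lemma expressible_history:
  assumes M: "transitive M" "\<And>x y. x \<epsilon> M \<Longrightarrow> sub y x \<Longrightarrow> y \<epsilon> M" and n: "natural n" "i \<epsilon> n"
  shows "expressible M n (\<lambda>s. history (app s i))"
proof (rule expressible_cong)
  let ?n1 = "succ n" let ?n2 = "succ ?n1" let ?n3 = "succ ?n2"
  have "expressible M ?n2 (\<lambda>s. \<exists>y. y \<epsilon> M \<and> (y \<epsilon> app s i \<and> y \<epsilon> app s n \<and> sub (app s ?n1) y))"
    by (rule expressible_ex[where Q = "\<lambda>s. app s ?n2 \<epsilon> app s i \<and> app s ?n2 \<epsilon> app s n \<and>
          sub (app s ?n1) (app s ?n2)"])
      (auto simp: n app_extend[of _ _ M] M(1)
        intro!: expressible_conj expressible_mem expressible_sub)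
  then have "expressible M ?n1 (\<lambda>s. \<forall>x. x \<epsilon> M \<longrightarrow> (x \<epsilon> app s n \<longleftrightarrow>
      (\<exists>y. y \<epsilon> M \<and> (y \<epsilon> app s i \<and> y \<epsilon> app s n \<and> sub x y))))"
    by (intro expressible_all[where Q = "\<lambda>s. app s ?n1 \<epsilon> app s n \<longleftrightarrow>
          (\<exists>y. y \<epsilon> M \<and> (y \<epsilon> app s i \<and> y \<epsilon> app s n \<and> sub (app s ?n1) y))"])
      (auto simp: n app_extend[of _ _ M] intro!: expressible_iff expressible_mem)
  then show "expressible M n (\<lambda>s. \<forall>u. u \<epsilon> M \<longrightarrow> (u \<epsilon> app s i \<longrightarrow> (\<forall>x. x \<epsilon> M \<longrightarrow> (x \<epsilon> u \<longleftrightarrow>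
      (\<exists>y. y \<epsilon> M \<and> (y \<epsilon> app s i \<and> y \<epsilon> u \<and> sub x y))))))"
    by (intro expressible_all[where Q = "\<lambda>s. app s n \<epsilon> app s i \<longrightarrow> (\<forall>x. x \<epsilon> M \<longrightarrow> (x \<epsilon> app s n \<longleftrightarrow>
          (\<exists>y. y \<epsilon> M \<and> (y \<epsilon> app s i \<and> y \<epsilon> app s n \<and> sub x y))))"])
      (auto simp: n app_extend[of _ _ M] intro!: expressible_imp expressible_mem)
  show "(\<forall>u. u \<epsilon> M \<longrightarrow> (u \<epsilon> app s i \<longrightarrow> (\<forall>x. x \<epsilon> M \<longrightarrow> (x \<epsilon> u \<longleftrightarrow>
      (\<exists>y. y \<epsilon> M \<and> (y \<epsilon> app s i \<and> y \<epsilon> u \<and> sub x y)))))) \<longleftrightarrow> history (app s i)"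
    if s: "fun_from_to s n M" for s
  proof -
    have u: "u \<epsilon> M" if "u \<epsilon> app s i" for u
      using transitiveD[OF M(1) fun_app(2)[OF s n(2)] that] .
    define E where "E v x \<longleftrightarrow> (\<exists>y. y \<epsilon> app s i \<and> y \<epsilon> v \<and> sub x y)" for v x
    have E: "(\<exists>y. y \<epsilon> M \<and> (y \<epsilon> app s i \<and> y \<epsilon> v \<and> sub x y)) \<longleftrightarrow> E v x" for v x
      unfolding E_def using u by blast
    have "x \<epsilon> M" if "x \<epsilon> v" "v \<epsilon> app s i" for v x using transitiveD[OF M(1) u] that by blast
    moreover have "x \<epsilon> M" if "E v x" for v x using M(2) u that unfolding E_def by blast
    ultimately have "(\<forall>x. x \<epsilon> M \<longrightarrow> (x \<epsilon> v \<longleftrightarrow> E v x)) \<longleftrightarrow> (\<forall>x. x \<epsilon> v \<longleftrightarrow> E v x)" if "v \<epsilon> app s i" for v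
      using that by blast
    then show ?thesis unfolding E history_def E_def[symmetric] using u by (simp cong: imp_cong) blast
  qed
qed

section \<open>Relativization to a level\<close>

text \<open>
  The formula \<open>f'\<close> has a variable \<open>x\<^sub>c\<close> for \<open>v\<close>, which bounds the quantifiers, and \<open>r\<close> renames the
  free variables of \<open>f\<close>, so that formulas with different parameters can later be combined.
\<close>

lemma relativization:
  assumes "formula m f" "natural m'" "fun_from_to r m m'" "c \<epsilon> m'"
  shows "\<exists>f'. formula m' f' \<and> (\<forall>M v s s'. sub v M \<longrightarrow> fun_from_to s m v \<longrightarrow> fun_from_to s' m' M \<longrightarrow>
    app s' c = v \<longrightarrow> (\<forall>i. i \<epsilon> m \<longrightarrow> app s i = app s' (app r i)) \<longrightarrow>
    (satisfies M f' s' \<longleftrightarrow> satisfies v f s))"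
proof -
  \<comment> \<open>The same condition with \<open>ap\<close> in place of \<open>app\<close>, so
    that the induction on codes can be carried out in the model.\<close>
  define R where "R m f m' r c f' \<longleftrightarrow> (\<forall>M v s s'. sub v M \<longrightarrow> fun_from_to s m v \<longrightarrow>
    fun_from_to s' m' M \<longrightarrow> ap s' c = v \<longrightarrow> (\<forall>i. i \<epsilon> m \<longrightarrow> ap s i = ap s' (ap r i)) \<longrightarrow>
    (satisfies M f' s' \<longleftrightarrow> satisfies v f s))" for m f m' r c f'
  have R_iff: "R m f m' r c f' \<longleftrightarrow> (\<forall>M v s s'. sub v M \<longrightarrow> fun_from_to s m v \<longrightarrow>
    fun_from_to s' m' M \<longrightarrow> app s' c = v \<longrightarrow> (\<forall>i. i \<epsilon> m \<longrightarrow> app s i = app s' (app r i)) \<longrightarrow>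
    (satisfies M f' s' \<longleftrightarrow> satisfies v f s))" if "fun_from_to r m m'" "c \<epsilon> m'" for m f m' r c f'
  proof -
    have 1: "ap s' c = app s' c" if "fun_from_to s' m' M" for s' M
      using ap_eq[OF that] \<open>c \<epsilon> m'\<close> by blast
    have 2: "ap s i = ap s' (ap r i) \<longleftrightarrow> app s i = app s' (app r i)"
      if "fun_from_to s' m' M" "fun_from_to s m v" "i \<epsilon> m" for s s' M v i
      using ap_eq[OF \<open>fun_from_to r m m'\<close>] ap_eq[OF that(1)] ap_eq[OF that(2)] that(3)
        fun_app(2)[OF \<open>fun_from_to r m m'\<close>] by simp
    show ?thesis unfolding R_def
      by (intro all_cong1 imp_cong refl; ((rule 2; assumption) | simp add: 1))
  qed
  \<comment> \<open>The quantifier case applies the hypothesis to a longer context and an extended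
    renaming, so both are generalized.\<close>
  have "\<forall>m' r c. natural m' \<and> fun_from_to r m m' \<and> c \<epsilon> m' \<longrightarrow> (\<exists>f'. formula m' f' \<and> R m f m' r c f')"
    using assms(1)
  proof (induction rule: formula_induct)
    case fo
    show ?case unfolding R_def by (intro fo_intros)
  next
    case (mem m i j)
    show ?case
    proof (intro allI impI, elim conjE)
      fix m' r c assume h: "natural m'" "fun_from_to r m m'" "c \<epsilon> m'"
      have ij: "app r i \<epsilon> m'" "app r j \<epsilon> m'" using fun_app(2)[OF h(2)] mem by blast+
      have "R m (mem_code i j) m' r c (mem_code (app r i) (app r j))"
        unfolding R_iff[OF h(2,3)] using mem ij h by (simp add: satisfies_simps)
      then show "\<exists>f'. formula m' f' \<and> R m (mem_code i j) m' r c f'"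
        using formula_atom(1)[OF h(1) ij] by blast
    qed
  next
    case (eq m i j)
    show ?case
    proof (intro allI impI, elim conjE)
      fix m' r c assume h: "natural m'" "fun_from_to r m m'" "c \<epsilon> m'"
      have ij: "app r i \<epsilon> m'" "app r j \<epsilon> m'" using fun_app(2)[OF h(2)] eq by blast+
      have "R m (eq_code i j) m' r c (eq_code (app r i) (app r j))"
        unfolding R_iff[OF h(2,3)] using eq ij h by (simp add: satisfies_simps)
      then show "\<exists>f'. formula m' f' \<and> R m (eq_code i j) m' r c f'"
        using formula_atom(2)[OF h(1) ij] by blast
    qed
  next
    case (neg m f)
    show ?case
    proof (intro allI impI, elim conjE)
      fix m' r c assume h: "natural m'" "fun_from_to r m m'" "c \<epsilon> m'"
      then obtain g where g: "formula m' g" "R m f m' r c g" using neg.IH by blast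
      have "R m (neg_code f) m' r c (neg_code g)"
        using g(2) unfolding R_def
        by (simp add: satisfies_simps(3)[OF h(1) _ g(1)]
            satisfies_simps(3)[OF formula_natural[OF neg.hyps] _ neg.hyps])
      then show "\<exists>f'. formula m' f' \<and> R m (neg_code f) m' r c f'"
        using formula_neg[OF g(1)] by blast
    qed
  next
    case (conj m f1 f2)
    show ?case
    proof (intro allI impI, elim conjE)
      fix m' r c assume h: "natural m'" "fun_from_to r m m'" "c \<epsilon> m'"
      then obtain g1 g2 where g: "formula m' g1" "formula m' g2" "R m f1 m' r c g1" "R m f2 m' r c g2"
        using conj.IH by blast
      have "R m (conj_code f1 f2) m' r c (conj_code g1 g2)"
        using g(3,4) unfolding R_def
        by (simp add: satisfies_simps(4)[OF h(1) _ g(1,2)]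
            satisfies_simps(4)[OF formula_natural[OF conj.hyps(1)] _ conj.hyps])
      then show "\<exists>f'. formula m' f' \<and> R m (conj_code f1 f2) m' r c f'"
        using formula_conj[OF g(1,2)] by blast
    qed
  next
    case (all m f)
    show ?case
    proof (intro allI impI, elim conjE)
      fix m' r c assume h: "natural m'" "fun_from_to r m m'" "c \<epsilon> m'"
      \<comment> \<open>The variable bound in \<open>f\<close> has level \<open>m\<close>, the one
        bound in its translation has level \<open>m'\<close>.\<close>
      let ?r = "extend r m m'"
      have r0: "fun_from_to r m (succ m')" by (rule fun_mono[OF h(2)]) (simp add: sub_def)
      have r: "fun_from_to ?r (succ m) (succ m')" using fun_extend[OF r0] by simp
      have c: "c \<epsilon> succ m'" "natural (succ m')" using h by auto
      obtain g where g: "formula (succ m') g" "R (succ m) f (succ m') ?r c g"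
        using all.IH r c by blast
      \<comment> \<open>The codes have no implication; this one says that if the bound variable lies
        in variable \<open>c\<close>, then \<open>g\<close> holds.\<close>
      let ?b = "neg_code (conj_code (mem_code m' c) (neg_code g))"
      have a: "formula (succ m') (mem_code m' c)" using formula_atom(1)[OF c(2)] h by simp
      have b: "formula (succ m') ?b" using formula_neg formula_conj a g(1) by blast
      have "R m (all_code f) m' r c (all_code ?b)" unfolding R_iff[OF h(2,3)]
      proof (intro allI impI)
        fix M v s s'
        assume v: "sub v M" and s: "fun_from_to s m v" and s': "fun_from_to s' m' M"
          and c': "app s' c = v" and eq: "\<forall>i. i \<epsilon> m \<longrightarrow> app s i = app s' (app r i)"
        have *: "satisfies M ?b (extend s' m' a) \<longleftrightarrow> (a \<epsilon> v \<longrightarrow> satisfies v f (extend s m a))"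
          if "a \<epsilon> M" for a
        proof -
          note e = fun_extend[OF s' that]
          have "satisfies M (mem_code m' c) (extend s' m' a) \<longleftrightarrow> a \<epsilon> v"
            using satisfies_simps(1)[OF c(2) e] app_extend[OF s' that] h(3) c' by simp
          then have 1: "satisfies M ?b (extend s' m' a) \<longleftrightarrow> (a \<epsilon> v \<longrightarrow> satisfies M g (extend s' m' a))"
            using satisfies_simps(3)[OF c(2) e formula_conj[OF a formula_neg[OF g(1)]]]
              satisfies_simps(4)[OF c(2) e a formula_neg[OF g(1)]]
              satisfies_simps(3)[OF c(2) e g(1)] by blast
          have "satisfies M g (extend s' m' a) \<longleftrightarrow> satisfies v f (extend s m a)" if av: "a \<epsilon> v"
          proof -
            have "app (extend s' m' a) c = v" using app_extend[OF s' \<open>a \<epsilon> M\<close>] h(3) c' by simp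
            moreover have "\<forall>i. i \<epsilon> succ m \<longrightarrow>
                app (extend s m a) i = app (extend s' m' a) (app ?r i)"
            proof (intro allI impI)
              fix i assume "i \<epsilon> succ m"
              then consider "i \<epsilon> m" | "i = m" by auto
              then show "app (extend s m a) i = app (extend s' m' a) (app ?r i)"
              proof cases
                case 1
                then have "app ?r i = app r i" "app r i \<epsilon> m'"
                  using app_extend(2)[OF r0] fun_app(2)[OF h(2)] by auto
                then show ?thesis
                  using 1 eq app_extend(2)[OF s av] app_extend(2)[OF s' \<open>a \<epsilon> M\<close>] by simp
              next
                case 2
                then have "app ?r i = m'" using app_extend(1)[OF r0] by simp
                then show ?thesis
                  using 2 app_extend(1)[OF s av] app_extend(1)[OF s' \<open>a \<epsilon> M\<close>] by simp
              qed
            qed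
            ultimately show ?thesis
              using g(2)[unfolded R_iff[OF r c(1)]] v fun_extend[OF s av] e by blast
          qed
          then show ?thesis using 1 by blast
        qed
        have "satisfies M (all_code ?b) s' \<longleftrightarrow> (\<forall>a. a \<epsilon> M \<longrightarrow> a \<epsilon> v \<longrightarrow> satisfies v f (extend s m a))"
          using satisfies_simps(5)[OF h(1) s' b] * by simp
        also have "\<dots> \<longleftrightarrow> (\<forall>a. a \<epsilon> v \<longrightarrow> satisfies v f (extend s m a))"
          using v unfolding sub_def by blast
        also have "\<dots> \<longleftrightarrow> satisfies v (all_code f) s"
          using satisfies_simps(5)[OF all.hyps(1) s all.hyps(2)] by simp
        finally show "satisfies M (all_code ?b) s' \<longleftrightarrow> satisfies v (all_code f) s" .
      qed
      then show "\<exists>f'. formula m' f' \<and> R m (all_code f) m' r c f'"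
        using formula_all[OF h(1) b] by blast
    qed
  qed
  then obtain f' where "formula m' f'" "R m f m' r c f'" using assms by blast
  then show ?thesis unfolding R_iff[OF assms(3,4)] by blast
qed

text \<open>The formula \<open>g\<close> says: some v belongs to a history, includes the ordinal at
  position \<open>app r n\<close> without containing it, has entry \<open>j\<close> as an element,
  and makes the relativization of \<open>f\<close> true. The first conditions force v to be V_a, and
  \<open>succ a \<epsilon> t\<close> leaves room in V_t for the required history.\<close>

lemma lift_to_level:
  assumes t: "ordinal t" and f: "formula (succ n) f" and n: "natural n" and N: "natural N"
    and r: "fun_from_to r (succ n) N" and j: "j \<epsilon> N"
  shows "\<exists>g. formula N g \<and> (\<forall>a p s. ordinal a \<longrightarrow> succ a \<epsilon> t \<longrightarrow> fun_from_to p n a \<longrightarrow>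
    fun_from_to s N (V t) \<longrightarrow> (\<forall>i. i \<epsilon> n \<longrightarrow> app s (app r i) = app p i) \<longrightarrow> app s (app r n) = a \<longrightarrow>
    (satisfies (V t) g s \<longleftrightarrow> app s j \<epsilon> V a \<and> satisfies (V a) f (extend p n (app s j))))"
proof -
  let ?M = "V t" and ?k = "app r n"
  have k: "?k \<epsilon> N" using fun_app(2)[OF r] by simp
  have r_mem: "app r i \<epsilon> N" if "i \<epsilon> n" for i using fun_app(2)[OF r] that by simp
  \<comment> \<open>At argument \<open>n\<close> the map \<open>r\<close> locates the level
    \<open>a\<close>, whereas variable \<open>n\<close> of \<open>f\<close> is the tested element.
    The renaming for \<open>f\<close> therefore keeps \<open>r\<close> below \<open>n\<close> and
    sends \<open>n\<close> to \<open>j\<close>.\<close>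
  have "fot (\<lambda>e. ap r (e 0))" by (intro fo_intros)
  then obtain r0 where r0: "fun_from_to r0 n (succ N)" "\<And>i. i \<epsilon> n \<Longrightarrow> app r0 i = app r i"
    using lam_ex[of "ap r" n "succ N"] r_mem ap_eq[OF r] by auto
  let ?r = "extend r0 n j"
  have r': "fun_from_to ?r (succ n) (succ N)" using fun_extend[OF r0(1)] j by simp
  obtain f' where f': "formula (succ N) f'" and rel: "\<And>M v s s'. sub v M \<Longrightarrow>
      fun_from_to s (succ n) v \<Longrightarrow> fun_from_to s' (succ N) M \<Longrightarrow> app s' N = v \<Longrightarrow>
      (\<forall>i. i \<epsilon> succ n \<longrightarrow> app s i = app s' (app ?r i)) \<Longrightarrow> satisfies M f' s' \<longleftrightarrow> satisfies v f s"
    using relativization[OF f natural_succ[OF N] r', of N] by auto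
  note M = transitive_V[OF t] V_downward[OF t]
  define Q where "Q s v \<longleftrightarrow> sub (app s ?k) v \<and> \<not> app s ?k \<epsilon> v \<and>
    (\<exists>h. h \<epsilon> ?M \<and> (history h \<and> v \<epsilon> h)) \<and> app s j \<epsilon> v \<and> satisfies ?M f' (extend s N v)" for s v
  have "expressible ?M (succ N) (\<lambda>s. \<exists>h. h \<epsilon> ?M \<and> (history h \<and> app s N \<epsilon> h))"
    by (rule expressible_ex[where Q = "\<lambda>s. history (app s (succ N)) \<and> app s N \<epsilon> app s (succ N)"])
      (use N M in \<open>auto simp: app_extend[of _ _ ?M]
        intro!: expressible_conj expressible_history expressible_mem\<close>)
  then have "expressible ?M (succ N) (\<lambda>s. sub (app s ?k) (app s N) \<and> \<not> app s ?k \<epsilon> app s N \<and>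
      (\<exists>h. h \<epsilon> ?M \<and> (history h \<and> app s N \<epsilon> h)) \<and> app s j \<epsilon> app s N \<and> satisfies ?M f' s)"
    by (intro expressible_conj expressible_not expressible_sub expressible_mem
        expressible_satisfies M f') (use N k j in auto)
  then have "expressible ?M N (\<lambda>s. \<exists>v. v \<epsilon> ?M \<and> Q s v)"
    by (rule expressible_ex[OF N]) (simp add: Q_def app_extend[of _ _ ?M] k j)
  then obtain g where g: "formula N g"
    "\<And>s. fun_from_to s N ?M \<Longrightarrow> satisfies ?M g s \<longleftrightarrow> (\<exists>v. v \<epsilon> ?M \<and> Q s v)"
    unfolding expressible_def by blast
  have "satisfies ?M g s \<longleftrightarrow> app s j \<epsilon> V a \<and> satisfies (V a) f (extend p n (app s j))"
    if a: "ordinal a" "succ a \<epsilon> t" and p: "fun_from_to p n a" and s: "fun_from_to s N ?M"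
      and sp: "\<forall>i. i \<epsilon> n \<longrightarrow> app s (app r i) = app p i" and sk: "app s ?k = a" for a p s
  proof -
    have at: "a \<epsilon> t" using a(2) ordinal_trans[OF t] by auto
    have Va: "V a \<epsilon> ?M" "sub (V a) ?M" using V_mem_V[OF t at] V_mono[OF t at] by auto
    \<comment> \<open>Ensures that V_(a+2), which contains a history with V_a as a member, is
      included in V_t.\<close>
    have "succ (succ a) \<epsilon> t \<or> succ (succ a) = t"
      using ordinal_linear[OF ordinal_succ[OF ordinal_succ[OF a(1)]] t] a(2)
        mem_asym[of t "succ a"] mem_irrefl[of t] by auto
    then have "sub (V (succ (succ a))) ?M" using V_mono[OF t] by (auto simp: sub_def)
    then obtain h where "h \<epsilon> ?M" "history h" "V a \<epsilon> h"
      using history_ex[OF a(1)] unfolding sub_def by blast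
    moreover have "sub a (V a)" "\<not> a \<epsilon> V a"
      using ordinal_sub_V[OF a(1)] ordinal_mem_V_iff[OF a(1) a(1)] by auto
    ultimately have Q: "v \<epsilon> ?M \<and> Q s v \<longleftrightarrow>
        v = V a \<and> app s j \<epsilon> V a \<and> satisfies ?M f' (extend s N (V a))" for v
      unfolding Q_def sk using history_eq_V[OF a(1), of _ v] Va(1) by auto
    have "satisfies ?M f' (extend s N (V a)) \<longleftrightarrow> satisfies (V a) f (extend p n (app s j))"
      if sj: "app s j \<epsilon> V a"
    proof (rule rel[OF Va(2) _ fun_extend[OF s Va(1)] app_extend(1)[OF s Va(1)]])
      have p': "fun_from_to p n (V a)" using fun_mono[OF p ordinal_sub_V[OF a(1)]] .
      show "fun_from_to (extend p n (app s j)) (succ n) (V a)" using fun_extend[OF p' sj] .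
      show "\<forall>i. i \<epsilon> succ n \<longrightarrow>
          app (extend p n (app s j)) i = app (extend s N (V a)) (app ?r i)"
      proof (intro allI impI)
        fix i assume "i \<epsilon> succ n"
        then consider "i \<epsilon> n" | "i = n" by auto
        then show "app (extend p n (app s j)) i = app (extend s N (V a)) (app ?r i)"
        proof cases
          case 1
          then have "app ?r i = app r i" using app_extend(2)[OF r0(1)] r0(2) j by simp
          then show ?thesis
            using 1 app_extend(2)[OF p' sj] app_extend(2)[OF s Va(1) r_mem[OF 1]] sp by simp
        next
          case 2
          then have "app ?r i = j" using app_extend(1)[OF r0(1)] j by simp
          then show ?thesis using 2 app_extend(1)[OF p' sj] app_extend(2)[OF s Va(1) j] by simp
        qed
      qed
    qed
    then show ?thesis unfolding g(2)[OF s] Q by blast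
  qed
  then show ?thesis using g(1) by blast
qed

section \<open>Sets cut out by formulas with ordinal parameters\<close>

definition od_witness :: "'v \<Rightarrow> 'v \<Rightarrow> 'v \<Rightarrow> 'v \<Rightarrow> 'v \<Rightarrow> bool" where
  "od_witness t X n f p \<longleftrightarrow> ordinal t \<and> natural n \<and> formula (succ n) f \<and> fun_from_to p n t \<and>
     (\<forall>b. b \<epsilon> X \<longleftrightarrow> b \<epsilon> V t \<and> satisfies (V t) f (extend p n b))"

definition od_set :: "'v \<Rightarrow> 'v \<Rightarrow> bool" where
  "od_set t X \<longleftrightarrow> (\<exists>n f p. od_witness t X n f p)"

text \<open>This is what permits the induction along a finite enumeration of possibly nonstandard
  length: formula, parameters and level are all quantified inside the model.\<close>

lemma fo_od_set [fo_intros]: "fot u \<Longrightarrow> fot v \<Longrightarrow> fo (\<lambda>e. od_set (u e) (v e))"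
proof (rule fo_subst2[of od_set])
  have "od_set t X \<longleftrightarrow> ordinal t \<and> (\<exists>n f p. natural n \<and> formula (succ n) f \<and> fun_from_to p n t \<and>
     (\<forall>b. b \<epsilon> X \<longleftrightarrow> b \<epsilon> Vo t \<and> satisfies (Vo t) f (extend p n b)))" for t X
    by (cases "ordinal t") (simp_all add: Vo_eq od_set_def od_witness_def)
  then show "fo (\<lambda>e. od_set (e 0) (e 1))" by (simp only:) (intro fo_intros)
qed

lemma od_set_ordinal: "od_set t X \<Longrightarrow> ordinal t"
  unfolding od_set_def od_witness_def by blast

lemma od_set_sub: "od_set t X \<Longrightarrow> sub X (V t)"
  unfolding od_set_def od_witness_def sub_def by blast

text \<open>The level \<open>a\<close> is appended to the parameters \<open>p\<close>; from it V_t
  recovers V_a and with it the original meaning of \<open>f\<close>.\<close>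

lemma lift_od_set:
  assumes w: "od_witness a X n f p" and t: "ordinal t" "succ a \<epsilon> t" and N: "natural N"
    and r: "fun_from_to r (succ n) N" and j: "j \<epsilon> N"
  shows "\<exists>g. formula N g \<and> (\<forall>s. fun_from_to s N (V t) \<longrightarrow>
    (\<forall>i. i \<epsilon> succ n \<longrightarrow> app s (app r i) = app (extend p n a) i) \<longrightarrow>
    (satisfies (V t) g s \<longleftrightarrow> app s j \<epsilon> X))"
proof -
  have w': "ordinal a" "natural n" "formula (succ n) f" "fun_from_to p n a"
    "\<And>b. b \<epsilon> X \<longleftrightarrow> b \<epsilon> V a \<and> satisfies (V a) f (extend p n b)"
    using w unfolding od_witness_def by blast+
  obtain g where g: "formula N g" "\<forall>a p s. ordinal a \<longrightarrow> succ a \<epsilon> t \<longrightarrow> fun_from_to p n a \<longrightarrow>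
    fun_from_to s N (V t) \<longrightarrow> (\<forall>i. i \<epsilon> n \<longrightarrow> app s (app r i) = app p i) \<longrightarrow> app s (app r n) = a \<longrightarrow>
    (satisfies (V t) g s \<longleftrightarrow> app s j \<epsilon> V a \<and> satisfies (V a) f (extend p n (app s j)))"
    using lift_to_level[OF t(1) w'(3,2) N r j] by blast
  have p: "fun_from_to p n (succ a)" using fun_mono[OF w'(4)] by (simp add: sub_def)
  have "satisfies (V t) g s \<longleftrightarrow> app s j \<epsilon> X" if s: "fun_from_to s N (V t)"
    and eq: "\<forall>i. i \<epsilon> succ n \<longrightarrow> app s (app r i) = app (extend p n a) i" for s
  proof -
    have "\<forall>i. i \<epsilon> n \<longrightarrow> app s (app r i) = app p i" "app s (app r n) = a"
      using eq app_extend[OF p, of a] by auto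
    then show ?thesis using g(2) w' t(2) s by blast
  qed
  then show ?thesis using g(1) by blast
qed

text \<open>Since the lengths may be nonstandard, the entries of \<open>p2\<close> are appended to
  \<open>p1\<close> one at a time by an induction in the model. Recording where the entries went by
  \<open>r1\<close> and \<open>r2\<close> avoids addition of natural numbers.\<close>

lemma merge_sequences:
  assumes "natural n1" "fun_from_to p1 n1 P" "natural n2" "fun_from_to p2 n2 P"
  shows "\<exists>N q r1 r2. natural N \<and> fun_from_to q N P \<and> fun_from_to r1 n1 N \<and> fun_from_to r2 n2 N \<and>
    (\<forall>i. i \<epsilon> n1 \<longrightarrow> app q (app r1 i) = app p1 i) \<and> (\<forall>i. i \<epsilon> n2 \<longrightarrow> app q (app r2 i) = app p2 i)"
proof -
  define G where "G k N q r1 r2 \<longleftrightarrow> natural N \<and> fun_from_to q N P \<and> fun_from_to r1 n1 N \<and>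
    fun_from_to r2 k N \<and> (\<forall>i. i \<epsilon> n1 \<longrightarrow> ap q (ap r1 i) = ap p1 i) \<and>
    (\<forall>i. i \<epsilon> k \<longrightarrow> ap q (ap r2 i) = ap p2 i)" for k N q r1 r2
  have G_iff: "G k N q r1 r2 \<longleftrightarrow> natural N \<and> fun_from_to q N P \<and> fun_from_to r1 n1 N \<and>
    fun_from_to r2 k N \<and> (\<forall>i. i \<epsilon> n1 \<longrightarrow> app q (app r1 i) = app p1 i) \<and>
    (\<forall>i. i \<epsilon> k \<longrightarrow> app q (app r2 i) = app p2 i)" if "sub k n2" for k N q r1 r2
  proof -
    have 1: "ap q (ap r1 i) = app q (app r1 i)"
      if "fun_from_to q N P" "fun_from_to r1 n1 N" "i \<epsilon> n1" for i
      using ap_eq[OF that(1)] ap_eq[OF that(2)] fun_app(2)[OF that(2)] that(3) by simp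
    have 2: "ap q (ap r2 i) = app q (app r2 i)"
      if "fun_from_to q N P" "fun_from_to r2 k N" "i \<epsilon> k" for i
      using ap_eq[OF that(1)] ap_eq[OF that(2)] fun_app(2)[OF that(2)] that(3) by simp
    have 3: "ap p1 i = app p1 i" if "i \<epsilon> n1" for i using ap_eq[OF assms(2) that] .
    have 4: "ap p2 i = app p2 i" if "i \<epsilon> k" for i
      using ap_eq[OF assms(4)] that \<open>sub k n2\<close> unfolding sub_def by blast
    show ?thesis unfolding G_def
      by (intro conj_cong all_cong1 imp_cong refl) (simp_all add: 1 2 3 4)
  qed
  have "sub n2 n2 \<longrightarrow> (\<exists>N q r1 r2. G n2 N q r1 r2)" using assms(3)
  proof (induction rule: natural_induct[where P = "\<lambda>k. sub k n2 \<longrightarrow> (\<exists>N q r1 r2. G k N q r1 r2)"])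
    case fo
    show ?case unfolding G_def by (intro fo_intros)
  next
    case zero
    have "fot (\<lambda>e. e 0)" by (intro fo_intros)
    then obtain r where r: "fun_from_to r n1 n1" "\<And>i. i \<epsilon> n1 \<Longrightarrow> app r i = i"
      using lam_ex[of "\<lambda>i. i" n1 n1] by auto
    have z: "sub zero n2" by (simp add: sub_def)
    have "G zero n1 p1 r zero"
      unfolding G_iff[OF z] using assms r by (simp add: fun_from_to_def[of _ zero])
    then show ?case by blast
  next
    case (succ k)
    show ?case
    proof
      assume k: "sub (succ k) n2"
      then have k': "k \<epsilon> n2" "sub k n2" by (auto simp: sub_def)
      then obtain N q r1 r2 where "G k N q r1 r2" using succ by blast
      then have G: "natural N" "fun_from_to q N P" "fun_from_to r1 n1 N" "fun_from_to r2 k N"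
        "\<And>i. i \<epsilon> n1 \<Longrightarrow> app q (app r1 i) = app p1 i" "\<And>i. i \<epsilon> k \<Longrightarrow> app q (app r2 i) = app p2 i"
        unfolding G_iff[OF k'(2)] by auto
      let ?a = "app p2 k"
      have a: "?a \<epsilon> P" using fun_app(2)[OF assms(4) k'(1)] .
      have s: "sub N (succ N)" by (simp add: sub_def)
      note r1 = fun_mono[OF G(3) s] and r2 = fun_mono[OF G(4) s]
      have N: "N \<epsilon> succ N" by simp
      have "app (extend q N ?a) (app r1 i) = app p1 i" if "i \<epsilon> n1" for i
        using app_extend(2)[OF G(2) a] fun_app(2)[OF G(3) that] G(5)[OF that] by simp
      moreover have "app (extend q N ?a) (app (extend r2 k N) i) = app p2 i" if "i \<epsilon> succ k" for i
      proof (cases "i = k")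
        case True
        then show ?thesis using app_extend(1)[OF r2 N] app_extend(1)[OF G(2) a] by simp
      next
        case False
        then have i: "i \<epsilon> k" using that by simp
        then show ?thesis
          using app_extend(2)[OF r2 N] app_extend(2)[OF G(2) a] fun_app(2)[OF G(4) i] G(6)[OF i]
          by simp
      qed
      ultimately have "G (succ k) (succ N) (extend q N ?a) r1 (extend r2 k N)"
        unfolding G_iff[OF k]
        using natural_succ[OF G(1)] fun_extend[OF G(2) a] r1 fun_extend[OF r2 N] by blast
      then show "\<exists>N q r1 r2. G (succ k) N q r1 r2" by blast
    qed
  qed
  then show ?thesis using G_iff[of n2] unfolding sub_def by blast
qed

section \<open>Restricting a set with ordinal parameters and singling out its least member\<close>

lemma od_witness_ext:
  "od_witness a X n f p \<Longrightarrow> ordinal t \<Longrightarrow> a \<epsilon> t \<Longrightarrow> fun_from_to (extend p n a) (succ n) t"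
  unfolding od_witness_def
  by (intro fun_extend fun_mono[of p n a t]) (auto simp: sub_def dest: ordinal_trans)

text \<open>In a common larger level, the conjunction of "x is in X" and "some y that meets the
  definition of d is an element of x" cuts out the new set.\<close>

lemma od_set_restrict:
  assumes "od_set a X" "od_set a' (upair d d)"
  shows "\<exists>t Y. od_set t Y \<and> (\<forall>b. b \<epsilon> Y \<longleftrightarrow> b \<epsilon> X \<and> d \<epsilon> b)"
proof -
  have o: "ordinal a" "ordinal a'" using assms od_set_ordinal by auto
  obtain n f p where w: "od_witness a X n f p" using assms unfolding od_set_def by blast
  obtain n' f' p' where w': "od_witness a' (upair d d) n' f' p'"
    using assms unfolding od_set_def by blast
  obtain c where c: "ordinal c" "a \<epsilon> c" "a' \<epsilon> c"
  proof (cases "a \<epsilon> a'")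
    case True
    then show ?thesis using that[of "succ a'"] o ordinal_succ by simp
  next
    case False
    then show ?thesis using that[of "succ a"] o ordinal_succ ordinal_linear[OF o] by auto
  qed
  \<comment> \<open>The levels \<open>a\<close> and \<open>a'\<close> are below \<open>c\<close>, so
    their successors are below \<open>t\<close>, as lifting requires.\<close>
  define t where "t = succ c"
  have t: "ordinal t" unfolding t_def using c ordinal_succ by blast
  have succ_t: "succ x \<epsilon> t" if "x \<epsilon> c" for x
    unfolding t_def
    using ordinal_sub_iff[OF ordinal_succ[OF ordinal_mem[OF c(1) that]] c(1)] that
      ordinal_trans[OF c(1) that] by (auto simp: sub_def)
  have at: "a \<epsilon> t" "a' \<epsilon> t" unfolding t_def using c by auto
  have n: "natural (succ n)" "natural (succ n')"
    using w w' unfolding od_witness_def by auto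
  obtain N q r r' where N: "natural N" and q: "fun_from_to q N t"
    and r: "fun_from_to r (succ n) N" and r': "fun_from_to r' (succ n') N"
    and eq: "\<forall>i. i \<epsilon> succ n \<longrightarrow> app q (app r i) = app (extend p n a) i"
    and eq': "\<forall>i. i \<epsilon> succ n' \<longrightarrow> app q (app r' i) = app (extend p' n' a') i"
    using merge_sequences[OF n(1) od_witness_ext[OF w t at(1)] n(2) od_witness_ext[OF w' t at(2)]]
    by blast
  let ?M = "V t"
  have N': "natural (succ N)" "natural (succ (succ N))" using N by auto
  have "fun_from_to r (succ n) (succ N)" using fun_mono[OF r] by (simp add: sub_def)
  \<comment> \<open>Entries below \<open>N\<close> hold the merged parameters, entry
    \<open>N\<close> holds the tested set, and entry \<open>succ N\<close> the candidate for
    \<open>d\<close>.\<close>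
  from lift_od_set[OF w t succ_t[OF c(2)] N'(1) this, of N] obtain g where
    g: "formula (succ N) g" "\<forall>s. fun_from_to s (succ N) ?M \<longrightarrow>
      (\<forall>i. i \<epsilon> succ n \<longrightarrow> app s (app r i) = app (extend p n a) i) \<longrightarrow>
      (satisfies ?M g s \<longleftrightarrow> app s N \<epsilon> X)" by auto
  have "fun_from_to r' (succ n') (succ (succ N))" using fun_mono[OF r'] by (simp add: sub_def)
  from lift_od_set[OF w' t succ_t[OF c(3)] N'(2) this, of "succ N"] obtain g' where
    g': "formula (succ (succ N)) g'" "\<forall>s. fun_from_to s (succ (succ N)) ?M \<longrightarrow>
      (\<forall>i. i \<epsilon> succ n' \<longrightarrow> app s (app r' i) = app (extend p' n' a') i) \<longrightarrow>
      (satisfies ?M g' s \<longleftrightarrow> app s (succ N) = d)" by auto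
  have "expressible ?M (succ N) (\<lambda>s. \<exists>x. x \<epsilon> ?M \<and>
      (satisfies ?M g' (extend s (succ N) x) \<and> x \<epsilon> app s N))"
    by (rule expressible_ex[where Q = "\<lambda>s. satisfies ?M g' s \<and> app s (succ N) \<epsilon> app s N"])
      (use N' g' in \<open>auto simp: app_extend[of _ _ ?M]
        intro!: expressible_conj expressible_satisfies expressible_mem\<close>)
  then have "expressible ?M (succ N) (\<lambda>s. satisfies ?M g s \<and> (\<exists>x. x \<epsilon> ?M \<and>
      (satisfies ?M g' (extend s (succ N) x) \<and> x \<epsilon> app s N)))"
    by (rule expressible_conj[OF expressible_satisfies[OF g(1)]])
  then obtain k where k: "formula (succ N) k" "\<And>s. fun_from_to s (succ N) ?M \<Longrightarrow>
      satisfies ?M k s \<longleftrightarrow> satisfies ?M g s \<and> (\<exists>x. x \<epsilon> ?M \<and>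
      (satisfies ?M g' (extend s (succ N) x) \<and> x \<epsilon> app s N))"
    unfolding expressible_def by blast
  have qM: "fun_from_to q N ?M" using fun_mono[OF q ordinal_sub_V[OF t]] .
  have d: "d \<epsilon> ?M"
    using od_set_sub[OF assms(2)] V_mono[OF t at(2)] by (auto simp: sub_def)
  have rN: "app r i \<epsilon> N" if "i \<epsilon> succ n" for i using fun_app(2)[OF r that] .
  have rN': "app r' i \<epsilon> N" if "i \<epsilon> succ n'" for i using fun_app(2)[OF r' that] .
  have main: "satisfies ?M k (extend q N b) \<longleftrightarrow> b \<epsilon> X \<and> d \<epsilon> b" if b: "b \<epsilon> ?M" for b
  proof -
    let ?s = "extend q N b"
    note s = fun_extend[OF qM b]
    have 1: "satisfies ?M g ?s \<longleftrightarrow> b \<epsilon> X"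
      using g(2) s eq app_extend[OF qM b] rN by simp
    have 2: "satisfies ?M g' (extend ?s (succ N) x) \<longleftrightarrow> x = d" if "x \<epsilon> ?M" for x
      using g'(2) fun_extend[OF s that] eq' app_extend[OF s that] app_extend[OF qM b] rN' by simp
    show ?thesis using k(2)[OF s] 1 2 d app_extend(1)[OF qM b] by auto
  qed
  obtain Y where Y: "\<And>b. b \<epsilon> Y \<longleftrightarrow> b \<epsilon> X \<and> d \<epsilon> b"
    by (rule separationE[of "\<lambda>b. d \<epsilon> b" X], intro fo_intros, blast)
  have "b \<epsilon> ?M" if "b \<epsilon> X" for b
    using that od_set_sub[OF assms(1)] V_mono[OF t at(1)] unfolding sub_def by blast
  then have "b \<epsilon> Y \<longleftrightarrow> b \<epsilon> ?M \<and> satisfies ?M k (extend q N b)" for b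
    using main Y by blast
  then have "od_witness t Y N k q" unfolding od_witness_def using t N k(1) q by blast
  then show ?thesis unfolding od_set_def using Y by blast
qed

text \<open>Being a member of X that is included in all members of X determines a set uniquely by
  extensionality, and this condition is expressible a little above the level at which X is cut
  out.\<close>

lemma od_set_least:
  assumes "od_set a X" "x \<epsilon> X" and least: "\<And>y. y \<epsilon> X \<Longrightarrow> sub x y"
  shows "\<exists>t. od_set t (upair x x)"
proof -
  have a: "ordinal a" using assms od_set_ordinal by auto
  obtain n f p where w: "od_witness a X n f p" using assms unfolding od_set_def by blast
  define t where "t = succ (succ a)"
  have t: "ordinal t" "succ a \<epsilon> t" "a \<epsilon> t" unfolding t_def using a ordinal_succ by auto
  let ?M = "V t" and ?N = "succ n" and ?q = "extend p n a"
  have N: "natural ?N" "natural (succ ?N)" "natural (succ (succ ?N))"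
    using w unfolding od_witness_def by auto
  have q: "fun_from_to ?q ?N t" using od_witness_ext[OF w t(1,3)] .
  have qM: "fun_from_to ?q ?N ?M" using fun_mono[OF q ordinal_sub_V[OF t(1)]] .
  have "fot (\<lambda>e. e 0)" by (intro fo_intros)
  then obtain r where r: "fun_from_to r ?N ?N" and r_id: "\<And>i. i \<epsilon> ?N \<Longrightarrow> app r i = i"
    using lam_ex[of "\<lambda>i. i" ?N ?N] by auto
  have "fun_from_to r ?N (succ ?N)" using fun_mono[OF r] by (simp add: sub_def)
  from lift_od_set[OF w t(1,2) N(2) this, of ?N] obtain g where
    g: "formula (succ ?N) g" "\<And>s. fun_from_to s (succ ?N) ?M \<Longrightarrow>
      (\<And>i. i \<epsilon> ?N \<Longrightarrow> app s i = app ?q i) \<Longrightarrow> satisfies ?M g s \<longleftrightarrow> app s ?N \<epsilon> X"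
    using r_id by auto
  have "fun_from_to r ?N (succ (succ ?N))" using fun_mono[OF r] by (simp add: sub_def)
  \<comment> \<open>The membership condition is lifted a second time because here it tests the
    competitor \<open>y\<close>, which sits one entry after the candidate.\<close>
  from lift_od_set[OF w t(1,2) N(3) this, of "succ ?N"] obtain g' where
    g': "formula (succ (succ ?N)) g'" "\<And>s. fun_from_to s (succ (succ ?N)) ?M \<Longrightarrow>
      (\<And>i. i \<epsilon> ?N \<Longrightarrow> app s i = app ?q i) \<Longrightarrow> satisfies ?M g' s \<longleftrightarrow> app s (succ ?N) \<epsilon> X"
    using r_id by auto
  have "expressible ?M (succ ?N) (\<lambda>s. \<forall>y. y \<epsilon> ?M \<longrightarrow>
      (satisfies ?M g' (extend s (succ ?N) y) \<longrightarrow> sub (app s ?N) y))"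
    by (rule expressible_all[where Q = "\<lambda>s. satisfies ?M g' s \<longrightarrow> sub (app s ?N) (app s (succ ?N))"])
      (use N g' transitive_V[OF t(1)] in \<open>auto simp: app_extend[of _ _ ?M]
        intro!: expressible_imp expressible_satisfies expressible_sub\<close>)
  then have "expressible ?M (succ ?N) (\<lambda>s. satisfies ?M g s \<and> (\<forall>y. y \<epsilon> ?M \<longrightarrow>
      (satisfies ?M g' (extend s (succ ?N) y) \<longrightarrow> sub (app s ?N) y)))"
    by (rule expressible_conj[OF expressible_satisfies[OF g(1)]])
  then obtain k where k: "formula (succ ?N) k" "\<And>s. fun_from_to s (succ ?N) ?M \<Longrightarrow>
      satisfies ?M k s \<longleftrightarrow> satisfies ?M g s \<and> (\<forall>y. y \<epsilon> ?M \<longrightarrow>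
      (satisfies ?M g' (extend s (succ ?N) y) \<longrightarrow> sub (app s ?N) y))"
    unfolding expressible_def by blast
  have X: "y \<epsilon> ?M" if "y \<epsilon> X" for y
    using that od_set_sub[OF assms(1)] V_mono[OF t(1,3)] unfolding sub_def by blast
  have "satisfies ?M k (extend ?q ?N b) \<longleftrightarrow> b = x" if b: "b \<epsilon> ?M" for b
  proof -
    let ?s = "extend ?q ?N b"
    note s = fun_extend[OF qM b] and b1 = app_extend(1)[OF qM b] and b2 = app_extend(2)[OF qM b]
    have 1: "satisfies ?M g ?s \<longleftrightarrow> b \<epsilon> X"
      using g(2)[OF s b2] b1 by simp
    have 2: "satisfies ?M g' (extend ?s (succ ?N) y) \<longleftrightarrow> y \<epsilon> X" if "y \<epsilon> ?M" for y
    proof -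
      have "app (extend ?s (succ ?N) y) i = app ?q i" if i: "i \<epsilon> ?N" for i
      proof -
        have "i \<epsilon> succ ?N" using i mem_succ[of i ?N] by blast
        then show ?thesis using trans[OF app_extend(2)[OF s \<open>y \<epsilon> ?M\<close>] b2[OF i]] by blast
      qed
      then show ?thesis using g'(2)[OF fun_extend[OF s that]] app_extend(1)[OF s that] by simp
    qed
    have "satisfies ?M k ?s \<longleftrightarrow> b \<epsilon> X \<and> (\<forall>y. y \<epsilon> X \<longrightarrow> sub b y)"
      using k(2)[OF s] 1 2 X b1 by auto
    also have "\<dots> \<longleftrightarrow> b = x"
    proof
      assume "b \<epsilon> X \<and> (\<forall>y. y \<epsilon> X \<longrightarrow> sub b y)"
      then have "sub b x" "sub x b" using assms(2) least by blast+
      then show "b = x" unfolding sub_def by (intro set_eqI) blast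
    qed (use assms(2) least in blast)
    finally show ?thesis .
  qed
  then have "b \<epsilon> upair x x \<longleftrightarrow> b \<epsilon> ?M \<and> satisfies ?M k (extend ?q ?N b)" for b
    using X[OF assms(2)] by auto
  then have "od_witness t (upair x x) ?N k ?q" unfolding od_witness_def using t N k(1) q by blast
  then show ?thesis unfolding od_set_def by blast
qed

section \<open>Algebraic sets of ordinal definable sets\<close>

text \<open>Treating a definable element as a singleton lets elements and sets share the same
  lifting lemma.\<close>

lemma ordinal_definable_iff: "ordinal_definable mem x \<longleftrightarrow> (\<exists>t. od_set t (upair x x))"
proof
  assume "ordinal_definable mem x"
  then obtain t n f p where "ordinal t" "natural n" "formula (succ n) f" "fun_from_to p n t"
    "\<And>b. b \<epsilon> V t \<and> satisfies (V t) f (extend p n b) \<longleftrightarrow> b = x"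
    unfolding ordinal_definable_def definable_in_def by blast
  then have "od_witness t (upair x x) n f p" unfolding od_witness_def mem_upair by blast
  then show "\<exists>t. od_set t (upair x x)" unfolding od_set_def by blast
next
  assume "\<exists>t. od_set t (upair x x)"
  then obtain t n f p where w: "od_witness t (upair x x) n f p" unfolding od_set_def by blast
  then have "x \<epsilon> V t" unfolding od_witness_def mem_upair by blast
  moreover have "definable_in mem (V t) t x"
    using w unfolding od_witness_def mem_upair definable_in_def by blast
  ultimately show "ordinal_definable mem x"
    using w unfolding ordinal_definable_def od_witness_def by blast
qed

lemma ordinal_algebraic_iff:
  "ordinal_algebraic mem x \<longleftrightarrow> (\<exists>t B. od_set t B \<and> finite_set mem B \<and> x \<epsilon> B)"
proof
  assume "ordinal_algebraic mem x"
  then show "\<exists>t B. od_set t B \<and> finite_set mem B \<and> x \<epsilon> B"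
    unfolding ordinal_algebraic_def algebraic_in_def od_set_def od_witness_def by blast
next
  assume "\<exists>t B. od_set t B \<and> finite_set mem B \<and> x \<epsilon> B"
  then obtain t B n f p where w: "od_witness t B n f p" "finite_set mem B" "x \<epsilon> B"
    unfolding od_set_def by blast
  then have "x \<epsilon> V t" unfolding od_witness_def by blast
  moreover have "algebraic_in mem (V t) t x"
    using w unfolding od_witness_def algebraic_in_def by blast
  ultimately show "ordinal_algebraic mem x"
    using w unfolding ordinal_algebraic_def od_witness_def by blast
qed

lemma finite_set_singleton: "finite_set mem (upair x x)"
proof -
  have "fot (\<lambda>e. x)" by (intro fo_intros)
  then obtain f where f: "fun_from_to f (succ zero) (upair x x)" "app f zero = x"
    using lam_ex[of "\<lambda>_. x" "succ zero" "upair x x"] by auto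
  then show ?thesis
    unfolding finite_set_def by (intro exI[of _ "succ zero"] exI[of _ f]) auto
qed

lemma ordinal_algebraic_of_definable: "ordinal_definable mem x \<Longrightarrow> ordinal_algebraic mem x"
  unfolding ordinal_definable_iff ordinal_algebraic_iff using finite_set_singleton mem_upair by metis

lemma fo_ordinal_definable [fo_intros]: "fot s \<Longrightarrow> fo (\<lambda>e. ordinal_definable mem (s e))"
  by (rule fo_subst1[of "ordinal_definable mem"], unfold ordinal_definable_iff) (intro fo_intros)

lemma ordinal_definable_of_algebraic:
  assumes "ordinal_algebraic mem a" and elems: "\<And>x. x \<epsilon> a \<Longrightarrow> ordinal_definable mem x"
  shows "ordinal_definable mem a"
proof -
  obtain t0 B where B: "od_set t0 B" "finite_set mem B" "a \<epsilon> B"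
    using assms(1) unfolding ordinal_algebraic_iff by blast
  obtain n f where n: "natural n" and f: "fun_from_to f n B"
    and onto: "\<And>y. y \<epsilon> B \<Longrightarrow> \<exists>i. i \<epsilon> n \<and> app f i = y"
    using B(2) unfolding finite_set_def by blast
  \<comment> \<open>The level \<open>t\<close> is quantified inside the claim, as it may rise at
    each stage. The clause \<open>sub X B\<close> is kept so that the enumeration \<open>f\<close>
    still reaches every member of the final set.\<close>
  have "sub n n \<longrightarrow> (\<exists>t X. od_set t X \<and> a \<epsilon> X \<and> sub X B \<and>
      (\<forall>i. i \<epsilon> n \<longrightarrow> ap f i \<epsilon> X \<longrightarrow> sub a (ap f i)))"
    using n
  proof (induction rule: natural_induct[where P = "\<lambda>k. sub k n \<longrightarrow> (\<exists>t X. od_set t X \<and> a \<epsilon> X \<and>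
        sub X B \<and> (\<forall>i. i \<epsilon> k \<longrightarrow> ap f i \<epsilon> X \<longrightarrow> sub a (ap f i)))"])
    case fo
    show ?case by (intro fo_intros)
  next
    case zero
    have "sub B B" by (simp add: sub_def)
    then show ?case using B mem_zero by blast
  next
    case (succ k)
    show ?case
    proof
      assume "sub (succ k) n"
      then have "sub k n" by (simp add: sub_def)
      then obtain t X where X: "od_set t X" "a \<epsilon> X" "sub X B"
        "\<And>i. i \<epsilon> k \<Longrightarrow> ap f i \<epsilon> X \<Longrightarrow> sub a (ap f i)" using succ by blast
      show "\<exists>t X. od_set t X \<and> a \<epsilon> X \<and> sub X B \<and>
          (\<forall>i. i \<epsilon> succ k \<longrightarrow> ap f i \<epsilon> X \<longrightarrow> sub a (ap f i))"
      proof (cases "sub a (ap f k)")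
        case True
        then have "\<forall>i. i \<epsilon> succ k \<longrightarrow> ap f i \<epsilon> X \<longrightarrow> sub a (ap f i)" using X(4) by auto
        then show ?thesis using X by blast
      next
        case False
        then obtain d where d: "d \<epsilon> a" "\<not> d \<epsilon> ap f k" unfolding sub_def by blast
        obtain t' where "od_set t' (upair d d)"
          using elems[OF d(1)] unfolding ordinal_definable_iff by blast
        then obtain u Y where Y: "od_set u Y" "\<And>b. b \<epsilon> Y \<longleftrightarrow> b \<epsilon> X \<and> d \<epsilon> b"
          using od_set_restrict[OF X(1)] by blast
        have "a \<epsilon> Y" "sub Y B" using Y(2) X(2,3) d(1) unfolding sub_def by auto
        \<comment> \<open>For i = k the claim is vacuous because \<open>d\<close> keeps this entry
          out of \<open>Y\<close>; for smaller indices \<open>Y\<close> inherits the property from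
          \<open>X\<close>.\<close>
        moreover have "\<forall>i. i \<epsilon> succ k \<longrightarrow> ap f i \<epsilon> Y \<longrightarrow> sub a (ap f i)"
          using X(4) Y(2) d(2) by auto
        ultimately show ?thesis using Y(1) by blast
      qed
    qed
  qed
  then obtain t X where X: "od_set t X" "a \<epsilon> X" "sub X B"
    "\<And>i. i \<epsilon> n \<Longrightarrow> ap f i \<epsilon> X \<Longrightarrow> sub a (ap f i)" unfolding sub_def by blast
  have "sub a y" if y: "y \<epsilon> X" for y
  proof -
    obtain i where "i \<epsilon> n" "app f i = y" using onto y X(3) unfolding sub_def by blast
    then show ?thesis using X(4)[of i] ap_eq[OF f] y by simp
  qed
  then show ?thesis unfolding ordinal_definable_iff using od_set_least[OF X(1,2)] by blast
qed

text \<open>Ordinal definability is first-order, so the counterexamples in the transitive closure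
  form a set. The elements of an \<in>-minimal one stay in the closure and are therefore ordinal
  definable.\<close>

lemma HOA_subset_HOD: "HOA mem \<subseteq> HOD mem"
proof
  fix a assume a: "a \<in> HOA mem"
  let ?t = "trcl mem (upair a a)"
  obtain w where w: "\<And>x. x \<epsilon> w \<longleftrightarrow> x \<epsilon> ?t \<and> \<not> ordinal_definable mem x"
    by (rule separationE[of "\<lambda>x. \<not> ordinal_definable mem x" ?t], intro fo_intros, blast)
  have "\<not> (\<exists>x. x \<epsilon> w)"
  proof
    assume "\<exists>x. x \<epsilon> w"
    then obtain x where x: "x \<epsilon> w" "\<And>z. z \<epsilon> w \<Longrightarrow> \<not> z \<epsilon> x" using foundation[of w] by blast
    have "ordinal_definable mem x"
    proof (rule ordinal_definable_of_algebraic)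
      show "ordinal_algebraic mem x" using a x(1) w unfolding HOA_def by blast
      show "ordinal_definable mem y" if "y \<epsilon> x" for y
        using that x w transitiveD[OF transitive_trcl] by blast
    qed
    then show False using x(1) w by blast
  qed
  then show "a \<in> HOD mem" using w unfolding HOD_def by blast
qed

lemma HOD_subset_HOA: "HOD mem \<subseteq> HOA mem"
  unfolding HOD_def HOA_def using ordinal_algebraic_of_definable by blast

end

theorem theorem1:
  fixes mem :: "'v \<Rightarrow> 'v \<Rightarrow> bool"
  assumes "ZFC mem"
  shows "HOA mem = HOD mem"
  using ZFC.HOA_subset_HOD[OF assms] ZFC.HOD_subset_HOA[OF assms] by (rule subset_antisym)

end
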